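(* Let $\mathcal{L}=\{L_\alpha\}_{\alpha\in\tau}$ be a lamination by graphs over the unit disk $\mathbb{D}$ in $\mathbb{C}^2$, $L_\alpha=\{w=\varphi_\alpha(z)\}$. Let $1<p<\infty$ and let $f\in C^1(\mathcal{L})$. Then there exists a sequence $(f_n)$ of smooth functions on $\mathbb{D}\times\mathbb{C}$ such that $\|f-f_n\|_{W^{1,p}}\to 0$ on every compact set, i.e. for every compact $K\subset\mathbb{D}$, $$\sup_{\alpha\in\tau,\ z\in K}\left|f(z,\varphi_\alpha(z))-f_n(z,\varphi_\alpha(z))\right|+\sup_{\alpha\in\tau}\left\|\nabla_{L_\alpha}(f-f_n)\right\|_{L^p(L_\alpha\cap (K\times\mathbb{C}))}\longrightarrow 0\quad (n\to\infty).$$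
   Context: Lamination by graphs over $\mathbb{D}$: a family $\mathcal{L}$ of pairwise disjoint graphs $L_\alpha=\{(z,\varphi_\alpha(z)):z\in\mathbb{D}\}$ of holomorphic functions $\varphi_\alpha:\mathbb{D}\to\mathbb{C}$, indexed by $\alpha\in\tau$, where $\tau\subset\mathbb{D}$ (identified with a subset of $\{0\}\times\mathbb{D}$) and $\varphi_\alpha(0)=\alpha$. One assumes that there is $\eta>0$ such that $|\varphi_\alpha(z)|\le 1-\eta<1$ for all $\alpha\in\tau$, $z\in\mathbb{D}$, and that $\tau$ is closed. The $L_\alpha$ are called the leaves. A function on $\mathcal{L}$ is a function on the union of the leaves. $C^1(\mathcal{L})$: the functions $f$ on $\mathcal{L}$ which are $C^1$ along the leaves and whose derivatives along the leaves are transversally continuous; that is, $f$ is continuous, $z\mapsto f(z,\varphi_\alpha(z))$ is $C^1$ for every $\alpha$, and its first-order derivatives are continuous functions on the union of the leaves (equivalently, continuous in $(z,\alpha)\in\mathbb{D}\times\tau$). $\nabla_L$ is the gradient along the leaf $L$ (using the coordinate $z$ on $L_\alpha$ or the induced metric gives equivalent norms on compact sets), and $\|f\|_{W^{1,p}}=\|f\|_{L^\infty}+\sup_{L\in\mathcal{L}}\|\nabla_L f\|_{L^p}$. *)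

theory Defs
  imports "HOL-Analysis.Analysis"
begin

abbreviation unit_disk :: "complex set" where
  "unit_disk \<equiv> ball 0 1"

definition leaf :: "(complex \<Rightarrow> complex \<Rightarrow> complex) \<Rightarrow> complex \<Rightarrow> (complex \<times> complex) set" where
  "leaf \<phi> \<alpha> = {(z, \<phi> \<alpha> z) | z. z \<in> unit_disk}"

(* The values of \<phi> \<alpha> off the open disk, and of \<phi> \<alpha> for \<alpha> outside \<tau>, are irrelevant. *)
definition graph_lamination :: "complex set \<Rightarrow> (complex \<Rightarrow> complex \<Rightarrow> complex) \<Rightarrow> bool" where
  "graph_lamination \<tau> \<phi> \<longleftrightarrow>
     \<tau> \<subseteq> unit_disk \<and> closed \<tau> \<and>
     (\<forall>\<alpha>\<in>\<tau>. \<phi> \<alpha> holomorphic_on unit_disk \<and> \<phi> \<alpha> 0 = \<alpha>) \<and>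
     disjoint_family_on (leaf \<phi>) \<tau> \<and>
     (\<exists>\<eta>>0. \<forall>\<alpha>\<in>\<tau>. \<forall>z\<in>unit_disk. norm (\<phi> \<alpha> z) \<le> 1 - \<eta>)"

definition on_leaf ::
  "(complex \<Rightarrow> complex \<Rightarrow> complex) \<Rightarrow> complex \<Rightarrow> (complex \<times> complex \<Rightarrow> complex) \<Rightarrow> complex \<Rightarrow> complex" where
  "on_leaf \<phi> \<alpha> f = (\<lambda>z. f (z, \<phi> \<alpha> z))"

(* The real gradient in the coordinate z = x + iy: the pair of the x- and the y-derivative.
   Its norm in the product type is the Euclidean one. *)
definition leaf_grad ::
  "(complex \<Rightarrow> complex \<Rightarrow> complex) \<Rightarrow> complex \<Rightarrow> (complex \<times> complex \<Rightarrow> complex) \<Rightarrow> complex \<Rightarrow> complex \<times> complex" where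
  "leaf_grad \<phi> \<alpha> f z =
     (frechet_derivative (on_leaf \<phi> \<alpha> f) (at z) 1, frechet_derivative (on_leaf \<phi> \<alpha> f) (at z) \<i>)"

(* Only the values of f on the union of the leaves matter. The function G is the leafwise
   gradient, viewed as a function on that union. *)
definition C1_lamination ::
  "complex set \<Rightarrow> (complex \<Rightarrow> complex \<Rightarrow> complex) \<Rightarrow> (complex \<times> complex \<Rightarrow> complex) \<Rightarrow> bool" where
  "C1_lamination \<tau> \<phi> f \<longleftrightarrow>
     continuous_on (\<Union>\<alpha>\<in>\<tau>. leaf \<phi> \<alpha>) f \<and>
     (\<forall>\<alpha>\<in>\<tau>. \<forall>z\<in>unit_disk. on_leaf \<phi> \<alpha> f differentiable (at z)) \<and>
     (\<exists>G. continuous_on (\<Union>\<alpha>\<in>\<tau>. leaf \<phi> \<alpha>) G \<and>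
          (\<forall>\<alpha>\<in>\<tau>. \<forall>z\<in>unit_disk. G (z, \<phi> \<alpha> z) = leaf_grad \<phi> \<alpha> f z))"

(* Real differentiability classes; intended for open S. *)
primrec Ck_on :: "nat \<Rightarrow> 'a::real_normed_vector set \<Rightarrow> ('a \<Rightarrow> 'b::real_normed_vector) \<Rightarrow> bool" where
  "Ck_on 0 S f \<longleftrightarrow> continuous_on S f"
| "Ck_on (Suc k) S f \<longleftrightarrow>
     (\<forall>x\<in>S. f differentiable (at x)) \<and> (\<forall>v. Ck_on k S (\<lambda>x. frechet_derivative f (at x) v))"

definition smooth_on :: "'a::real_normed_vector set \<Rightarrow> ('a \<Rightarrow> 'b::real_normed_vector) \<Rightarrow> bool" where
  "smooth_on S f \<longleftrightarrow> (\<forall>k. Ck_on k S f)"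

(* The norms are extended-valued, so that unbounded suprema and divergent integrals give \<infinity>. *)
definition Lp_norm_on ::
  "real \<Rightarrow> 'a::euclidean_space set \<Rightarrow> ('a \<Rightarrow> 'b::real_normed_vector) \<Rightarrow> ennreal" where
  "Lp_norm_on p K g =
     (let I = (\<integral>\<^sup>+x\<in>K. ennreal (norm (g x) powr p) \<partial>lborel)
      in if I = \<infinity> then \<infinity> else ennreal (enn2real I powr (1 / p)))"

definition W1p_norm_on ::
  "complex set \<Rightarrow> (complex \<Rightarrow> complex \<Rightarrow> complex) \<Rightarrow> real \<Rightarrow> complex set \<Rightarrow>
     (complex \<times> complex \<Rightarrow> complex) \<Rightarrow> ennreal" where
  "W1p_norm_on \<tau> \<phi> p K g =
     (SUP (\<alpha>, z)\<in>\<tau> \<times> K. ennreal (norm (g (z, \<phi> \<alpha> z)))) +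
     (SUP \<alpha>\<in>\<tau>. Lp_norm_on p K (leaf_grad \<phi> \<alpha> g))"

end

theory Submission
  imports Defs "HOL-Complex_Analysis.Complex_Analysis"
begin

text \<open>The approximant is a weighted mean \<open>F(z, w) = \<Sum>j\<in>I. \<psi>\<^sub>j(z, w) P\<^sub>j(z)\<close>, where \<open>I\<close> is a finite \<open>d\<close>-net in
  \<open>\<tau>\<close>, \<open>P\<^sub>j\<close> is a smooth function \<open>C\<^sup>1\<close>-close to the restriction of \<open>f\<close> to the leaf of \<open>j\<close>, and \<open>\<psi>\<^sub>j\<close> is
  \<open>|w - \<phi>\<^sub>j(z)|\<close> to the power \<open>-2m\<close>, normalised to sum 1. Since \<open>d\<close> is tiny, the error is harmless as soon as the
  derivatives of the weights along every leaf are bounded independently of \<open>d\<close>, with decay away from the nearest point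
  of the net. The derivative of \<open>\<psi>\<^sub>j\<close> along the leaf of \<open>a\<close> is governed by the logarithmic derivatives of the
  ratios \<open>(\<phi>\<^sub>i - \<phi>\<^sub>a) / (\<phi>\<^sub>j - \<phi>\<^sub>a)\<close>. By disjointness of the leaves these are holomorphic and omit 0 and 1, so
  Schottky's theorem, sharpened to polynomial growth by extracting roots, controls them and compares them at
  different points of the disc; a large exponent \<open>m\<close> absorbs the polynomial loss. This gives uniform \<open>C\<^sup>1\<close>
  approximation along the leaves over compact subsets of the disc, which is stronger than the claim.\<close>

section \<open>Polynomial Schottky bounds\<close>

text \<open>The obstacle is that leaves have no common transversal scale: the distance of two leaves
  over 0 and over another point are related by a Hoelder bound only. A cut-off in \<open>w\<close>
  at a fixed scale is therefore not controlled along the leaves. Ratios of distances adapt to every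
  fibre, and normalising the weights leaves only differences of logarithmic derivatives, which are
  logarithmic derivatives of such ratios.

  The exponents are a budget of decay in \<open>y = norm (j - a) / d\<close>. The normalised weights
  are bounded by the sixth power of a quantity which is at most a multiple of
  \<open>1 / (1 + y)\<close>. The logarithmic derivative costs one power, the modulus of continuity
  of \<open>f\<close> another, and the fourth power that remains is summable over a planar net with
  a bound independent of \<open>d\<close>. Hence \<open>d\<close> can be chosen last, when the
  modulus of \<open>f\<close> is known.

  The inverse powers blow up on the leaves of the net. Clearing denominators gives the same weights
  a form that is smooth there too, and on such a leaf the mean is exactly
  \<open>P j\<close>.\<close>

lemma Schottky_ball:
  assumes "0 < t" "t < 1"
  obtains B :: real where "1 \<le> B"
    "\<And>f z. f holomorphic_on ball 0 1 \<Longrightarrow> (\<And>z. z \<in> ball 0 1 \<Longrightarrow> f z \<noteq> 0 \<and> f z \<noteq> 1) \<Longrightarrow>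
       norm (f 0) \<le> 2 \<Longrightarrow> norm z \<le> t \<Longrightarrow> norm (f z) \<le> B"
proof -
  \<comment> \<open>\<open>Schottky\<close> asks for holomorphy on the closed unit disc, so
    \<open>f\<close> is rescaled to a radius \<open>s\<close> strictly between \<open>t\<close> and
    1; points of norm at most \<open>t\<close> then have rescaled norm at most
    \<open>u < 1\<close>.\<close>
  define s where "s = (1 + t) / 2"
  have s: "0 < s" "s < 1" "t < s"
    using assms by (auto simp: s_def)
  define u where "u = t / s"
  have u: "0 < u" "u < 1"
    using s assms by (auto simp: u_def)
  define B where "B = exp (pi * exp (pi * (2 + 2 * 2 + 12 * u / (1 - u))))"
  show thesis
  proof
    show "1 \<le> B" by (simp add: B_def)
  next
    fix f :: "complex \<Rightarrow> complex" and z :: complex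
    assume f: "f holomorphic_on ball 0 1" "\<And>z. z \<in> ball 0 1 \<Longrightarrow> f z \<noteq> 0 \<and> f z \<noteq> 1"
      "norm (f 0) \<le> 2" and z: "norm z \<le> t"
    have le: "norm (of_real s * x) < 1" if "norm x \<le> 1" for x :: complex
    proof -
      have "norm (of_real s * x) = s * norm x" using s by (simp add: norm_mult)
      also have "\<dots> \<le> s * 1" using s that by (intro mult_left_mono) auto
      finally show ?thesis using s by simp
    qed
    have "norm (f (of_real s * (z / of_real s))) \<le> exp (pi * exp (pi * (2 + 2 * 2 + 12 * u / (1 - u))))"
    proof (rule Schottky[where f = "\<lambda>z. f (of_real s * z)"])
      show "(\<lambda>z. f (complex_of_real s * z)) holomorphic_on cball 0 1"
        using holomorphic_on_compose_gen[of "\<lambda>z. of_real s * z" "cball 0 1" f "ball 0 1"] f(1) le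
        by (auto simp: o_def holomorphic_on_linear image_subset_iff)
      show "norm (f (complex_of_real s * 0)) \<le> 2" using f by simp
      show "\<not> (f (complex_of_real s * x) = 0 \<or> f (complex_of_real s * x) = 1)" if "x \<in> cball 0 1" for x
        using f(2)[of "of_real s * x"] le[of x] that by auto
      show "norm (z / complex_of_real s) \<le> u"
        using z s by (simp add: norm_divide u_def divide_right_mono)
    qed (use u in auto)
    then show "norm (f z) \<le> B" using s by (simp add: B_def)
  qed
qed

text \<open>Chooses the order \<open>n\<close> of the root taken below: the \<open>n\<close>-th root
  of a number of size \<open>x\<close> has size at most 2, while \<open>2 ^ n \<le> 2 * x\<close>
  ensures that undoing the root costs only a power of \<open>x\<close>.\<close>

lemma power_of_two_between:
  fixes x :: real
  assumes "1 \<le> x"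
  obtains n where "0 < n" "x \<le> 2 ^ n" "2 ^ n \<le> 2 * x"
proof -
  obtain k where k: "x < 2 ^ k" using real_arch_pow[of 2 x] by auto
  define n where "n = (LEAST n. x < (2::real) ^ n)"
  have n: "x < 2 ^ n" unfolding n_def by (rule LeastI[of _ k]) (rule k)
  have "n \<noteq> 0" using n assms by (cases n) auto
  then obtain m where m: "n = Suc m" by (cases n) auto
  have "\<not> x < 2 ^ m" using not_less_Least[of m "\<lambda>n. x < (2::real) ^ n"] m n_def by auto
  then show thesis using that[of n] n m by auto
qed

text \<open>Taking \<open>n\<close>-th roots, which still omit 0 and 1, turns the bound of Schottky's theorem,
  which is doubly exponential in the value at the centre, into a polynomial one.\<close>

lemma Schottky_polynomial:
  assumes "0 < t" "t < 1"
  obtains C :: real and M :: nat where "1 \<le> C" "1 \<le> M"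
    "\<And>f z. f holomorphic_on ball 0 1 \<Longrightarrow> (\<And>z. z \<in> ball 0 1 \<Longrightarrow> f z \<noteq> 0 \<and> f z \<noteq> 1) \<Longrightarrow>
       norm z \<le> t \<Longrightarrow> norm (f z) \<le> C * max 1 (norm (f 0)) ^ M"
proof -
  obtain B :: real where B: "1 \<le> B"
    "\<And>f z. f holomorphic_on ball 0 1 \<Longrightarrow> (\<And>z. z \<in> ball 0 1 \<Longrightarrow> f z \<noteq> 0 \<and> f z \<noteq> 1) \<Longrightarrow>
       norm (f 0) \<le> 2 \<Longrightarrow> norm z \<le> t \<Longrightarrow> norm (f z) \<le> B"
    using Schottky_ball[OF assms] by blast
  \<comment> \<open>\<open>M\<close> is fixed before \<open>f\<close>, so the final exponent depends
    on \<open>t\<close> alone: a root is bounded by \<open>B \<le> 2 ^ M\<close>, hence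
    \<open>f\<close> by \<open>(2 ^ M) ^ n = (2 ^ n) ^ M\<close>.\<close>
  obtain M :: nat where M: "0 < M" "B \<le> 2 ^ M"
    using power_of_two_between[OF B(1)] by blast
  show thesis
  proof
    show "1 \<le> (2::real) ^ M" by simp
    show "1 \<le> M" using M by simp
  next
    fix f :: "complex \<Rightarrow> complex" and z :: complex
    assume f: "f holomorphic_on ball 0 1" "\<And>z. z \<in> ball 0 1 \<Longrightarrow> f z \<noteq> 0 \<and> f z \<noteq> 1"
      and z: "norm z \<le> t"
    define x where "x = max 1 (norm (f 0))"
    obtain n where n: "0 < n" "x \<le> 2 ^ n" "2 ^ n \<le> 2 * x"
      using power_of_two_between[of x] by (auto simp: x_def)
    obtain g where g: "g holomorphic_on ball 0 1" "\<And>z. z \<in> ball 0 1 \<Longrightarrow> exp (g z) = f z"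
      using holomorphic_logarithm_exists[of "ball 0 1" f 0] f by auto
    define h where "h = (\<lambda>z. exp (g z / of_nat n))"
    have h: "h z ^ n = f z" if "z \<in> ball 0 1" for z
      using g(2)[OF that] n(1) by (simp add: h_def flip: exp_of_nat_mult)
    have "h holomorphic_on ball 0 1"
      unfolding h_def using g(1) n(1) by (intro holomorphic_intros) auto
    moreover have "h z \<noteq> 0 \<and> h z \<noteq> 1" if "z \<in> ball 0 1" for z
      using h[OF that] f(2)[OF that] n(1) by (auto simp: h_def)
    moreover have "norm (h 0) \<le> 2"
    proof -
      have "norm (h 0) ^ n = norm (f 0)" using h[of 0] by (simp flip: norm_power)
      also have "\<dots> \<le> 2 ^ n" using n by (simp add: x_def)
      finally show ?thesis using n(1) by (simp add: power_mono_iff)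
    qed
    ultimately have hB: "norm (h z) \<le> B"
      using B(2) z by blast
    have "norm (f z) = norm (h z) ^ n"
      using h[of z] z assms by (simp flip: norm_power)
    also have "\<dots> \<le> (2 ^ M) ^ n"
      using hB M by (intro power_mono) auto
    also have "\<dots> = (2 ^ n) ^ M" by (simp add: mult.commute flip: power_mult)
    also have "\<dots> \<le> (2 * x) ^ M" using n by (intro power_mono) auto
    finally show "norm (f z) \<le> 2 ^ M * max 1 (norm (f 0)) ^ M"
      by (simp add: power_mult_distrib x_def)
  qed
qed

text \<open>The pseudo-hyperbolic distance is continuous and below 1 on the compact set
  \<open>cball 0 r \<times> cball 0 r\<close>, so its maximum is below 1. This converts bounds
  centred at 0 into bounds between arbitrary points.\<close>

lemma Moebius_function_uniform_bound:
  assumes "r < 1"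
  obtains t where "0 < t" "t < 1"
    "\<And>w z. norm w \<le> r \<Longrightarrow> norm z \<le> r \<Longrightarrow> norm (Moebius_function 0 w z) \<le> t"
proof (cases "r < 0")
  case True
  show thesis
  proof (rule that[of "1/2"])
    fix w z :: complex
    assume "norm w \<le> r"
    then show "norm (Moebius_function 0 w z) \<le> 1/2" using True norm_ge_zero[of w] by linarith
  qed auto
next
  case False
  have nz: "1 - cnj w * z \<noteq> 0" if "norm w \<le> r" "norm z \<le> r" for w z :: complex
  proof
    assume "1 - cnj w * z = 0"
    then have "norm w * norm z = 1" by (metis complex_mod_cnj eq_iff_diff_eq_0 norm_mult norm_one)
    moreover have "norm w * norm z \<le> r * 1"
      using that assms False by (intro mult_mono) auto
    ultimately show False using assms by simp
  qed
  let ?S = "cball 0 r \<times> cball 0 r :: (complex \<times> complex) set"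
  have "continuous_on ?S (\<lambda>x. norm ((snd x - fst x) / (1 - cnj (fst x) * snd x)))"
    using nz by (intro continuous_intros) auto
  moreover have "compact ?S" "?S \<noteq> {}" using False by (auto intro!: compact_Times)
  ultimately obtain x where x: "x \<in> ?S" "\<And>y. y \<in> ?S \<Longrightarrow>
     norm ((snd y - fst y) / (1 - cnj (fst y) * snd y)) \<le> norm ((snd x - fst x) / (1 - cnj (fst x) * snd x))"
    using continuous_attains_sup[of ?S "\<lambda>x. norm ((snd x - fst x) / (1 - cnj (fst x) * snd x))"] by blast
  define t where "t = norm ((snd x - fst x) / (1 - cnj (fst x) * snd x))"
  have t: "t < 1"
    using Moebius_function_norm_lt_1[of "fst x" "snd x" 0] x(1) assms
    by (auto simp: t_def Moebius_function_simple)
  have t2: "norm (Moebius_function 0 w z) \<le> t" if "norm w \<le> r" "norm z \<le> r" for w z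
    using x(2)[of "(w, z)"] that by (simp add: t_def Moebius_function_simple)
  show thesis
  \<comment> \<open>The maximum \<open>t\<close> is 0 when \<open>r = 0\<close>, and a positive
    bound is required.\<close>
  proof (rule that[of "max t (1/2)"])
    fix w z :: complex
    assume "norm w \<le> r" "norm z \<le> r"
    then show "norm (Moebius_function 0 w z) \<le> max t (1/2)" using t2[of w z] by simp
  qed (use t in auto)
qed

text \<open>Precomposing with the disc automorphism that sends 0 to \<open>w\<close> reduces this to
  the bound at the centre; the preimage of \<open>z\<close> stays in a disc whose radius depends on
  \<open>r\<close> only. As in Harnack's inequality, values at any two points become comparable,
  here up to a power.\<close>

lemma Schottky_Harnack:
  assumes "r < 1"
  obtains C :: real and M :: nat where "1 \<le> C" "1 \<le> M"
    "\<And>f z w. f holomorphic_on ball 0 1 \<Longrightarrow> (\<And>z. z \<in> ball 0 1 \<Longrightarrow> f z \<noteq> 0 \<and> f z \<noteq> 1) \<Longrightarrow>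
       norm z \<le> r \<Longrightarrow> norm w \<le> r \<Longrightarrow> norm (f z) \<le> C * max 1 (norm (f w)) ^ M"
proof -
  obtain t where t: "0 < t" "t < 1"
    "\<And>w z. norm w \<le> r \<Longrightarrow> norm z \<le> r \<Longrightarrow> norm (Moebius_function 0 w z) \<le> t"
    using Moebius_function_uniform_bound[OF assms] by blast
  obtain C :: real and M :: nat where CM: "1 \<le> C" "1 \<le> M"
    "\<And>f z. f holomorphic_on ball 0 1 \<Longrightarrow> (\<And>z. z \<in> ball 0 1 \<Longrightarrow> f z \<noteq> 0 \<and> f z \<noteq> 1) \<Longrightarrow>
       norm z \<le> t \<Longrightarrow> norm (f z) \<le> C * max 1 (norm (f 0)) ^ M"
    using Schottky_polynomial[OF t(1,2)] by blast
  show thesis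
  proof (rule that[OF CM(1,2)])
    fix f :: "complex \<Rightarrow> complex" and z w :: complex
    assume f: "f holomorphic_on ball 0 1" "\<And>z. z \<in> ball 0 1 \<Longrightarrow> f z \<noteq> 0 \<and> f z \<noteq> 1"
      and z: "norm z \<le> r" and w: "norm w \<le> r"
    have w1: "norm w < 1" and z1: "norm z < 1" using w z assms by auto
    \<comment> \<open>Sends 0 to \<open>w\<close> and \<open>Moebius_function 0 w z\<close> to
      \<open>z\<close>.\<close>
    let ?m = "Moebius_function 0 (-w)"
    have ball: "?m x \<in> ball 0 1" if "x \<in> ball 0 1" for x
      using Moebius_function_norm_lt_1[of "-w" x 0] w1 that by simp
    have "norm ((f \<circ> ?m) (Moebius_function 0 w z)) \<le> C * max 1 (norm ((f \<circ> ?m) 0)) ^ M"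
    proof (rule CM(3))
      show "f \<circ> ?m holomorphic_on ball 0 1"
        using Moebius_function_holomorphic[of "-w" 0] w1 f(1) ball
        by (intro holomorphic_on_compose_gen[of _ _ _ "ball 0 1"]) auto
    qed (use f(2) ball t(3) w z in auto)
    then show "norm (f z) \<le> C * max 1 (norm (f w)) ^ M"
      using Moebius_function_compose[of "-w" w z] w1 z1 by (simp add: Moebius_function_of_zero)
  qed
qed

text \<open>Cauchy's inequality on a circle of radius \<open>q\<close> about \<open>z\<close>, on
  which \<open>f\<close> is controlled by its value at the centre \<open>z\<close> itself.\<close>

lemma Schottky_deriv:
  assumes "r < 1"
  obtains C :: real and M :: nat where "1 \<le> C" "1 \<le> M"
    "\<And>f z. f holomorphic_on ball 0 1 \<Longrightarrow> (\<And>z. z \<in> ball 0 1 \<Longrightarrow> f z \<noteq> 0 \<and> f z \<noteq> 1) \<Longrightarrow>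
       norm z \<le> r \<Longrightarrow> norm (deriv f z) \<le> C * max 1 (norm (f z)) ^ M"
proof -
  define s where "s = (1 + r) / 2"
  have s: "r < s" "s < 1" using assms by (auto simp: s_def)
  define q :: real where "q = s - r"
  have q: "0 < q" using s by (simp add: q_def)
  obtain C :: real and M :: nat where CM: "1 \<le> C" "1 \<le> M"
    "\<And>f z w. f holomorphic_on ball 0 1 \<Longrightarrow> (\<And>z. z \<in> ball 0 1 \<Longrightarrow> f z \<noteq> 0 \<and> f z \<noteq> 1) \<Longrightarrow>
       norm z \<le> s \<Longrightarrow> norm w \<le> s \<Longrightarrow> norm (f z) \<le> C * max 1 (norm (f w)) ^ M"
    using Schottky_Harnack[OF s(2)] by blast
  show thesis
  proof (rule that[OF _ CM(2)])
    show "1 \<le> max 1 (C / q)" by simp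
  next
    fix f :: "complex \<Rightarrow> complex" and z :: complex
    assume f: "f holomorphic_on ball 0 1" "\<And>z. z \<in> ball 0 1 \<Longrightarrow> f z \<noteq> 0 \<and> f z \<noteq> 1"
      and z: "norm z \<le> r"
    define X where "X = max 1 (norm (f z)) ^ M"
    have X: "0 \<le> X" by (simp add: X_def)
    have near: "norm x \<le> s" if "norm (z - x) \<le> q" for x
      using norm_triangle_ineq4[of z "z - x"] z that by (simp add: q_def)
    have sub: "cball z q \<subseteq> ball 0 1"
    proof
      fix x assume "x \<in> cball z q"
      then show "x \<in> ball 0 1" using near[of x] s(2) by (simp add: dist_norm)
    qed
    have "norm ((deriv ^^ 1) f z) \<le> fact 1 * (C * X) / q ^ 1"
    proof (rule Cauchy_inequality)
      show "f holomorphic_on ball z q"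
        using f(1) sub ball_subset_cball holomorphic_on_subset by blast
      show "continuous_on (cball z q) f"
        using f(1) sub holomorphic_on_imp_continuous_on holomorphic_on_subset by blast
      show "norm (f x) \<le> C * X" if "norm (z - x) = q" for x
        unfolding X_def using f z s near[of x] that by (intro CM(3)) auto
    qed (rule q)
    also have "\<dots> \<le> max 1 (C / q) * X"
      using mult_right_mono[OF max.cobounded2[of "C / q" 1] X] by simp
    finally show "norm (deriv f z) \<le> max 1 (C / q) * max 1 (norm (f z)) ^ M" by (simp add: X_def)
  qed
qed

section \<open>Closure properties of smooth functions\<close>

lemma Ck_on_cong:
  assumes "open S" "\<And>x. x \<in> S \<Longrightarrow> f x = g x"
  shows "Ck_on k S f \<longleftrightarrow> Ck_on k S g"
  using assms(2)
proof (induction k arbitrary: f g)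
  case 0
  then show ?case by (auto cong: continuous_on_cong)
next
  case (Suc k)
  have D: "(f has_derivative D) (at x) \<longleftrightarrow> (g has_derivative D) (at x)" if "x \<in> S" for x D
    using Suc.prems assms(1) that
    by (metis has_derivative_transform_within_open)
  then have "frechet_derivative f (at x) = frechet_derivative g (at x)" if "x \<in> S" for x
    using that by (simp add: frechet_derivative_def)
  then have "Ck_on k S (\<lambda>x. frechet_derivative f (at x) v) = Ck_on k S (\<lambda>x. frechet_derivative g (at x) v)" for v
    by (intro Suc.IH) auto
  then show ?case using D by (auto simp: differentiable_def)
qed

text \<open>Replaces \<open>frechet_derivative\<close>, which is defined by choice, with an explicit
  formula \<open>D\<close>; the rules for concrete operations go through it.\<close>

lemma Ck_on_SucI:
  assumes "open S" "\<And>x. x \<in> S \<Longrightarrow> (f has_derivative D x) (at x)" "\<And>v. Ck_on k S (\<lambda>x. D x v)"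
  shows "Ck_on (Suc k) S f"
proof -
  have "Ck_on k S (\<lambda>x. frechet_derivative f (at x) v)" for v
    using Ck_on_cong[OF assms(1), of "\<lambda>x. frechet_derivative f (at x) v" "\<lambda>x. D x v" k]
      assms(3) frechet_derivative_at[OF assms(2)] by metis
  then show ?thesis using assms(2) by (auto simp: differentiable_def)
qed

lemma Ck_on_Suc_imp: "Ck_on (Suc k) S f \<Longrightarrow> Ck_on k S f"
proof (induction k arbitrary: f)
  case 0
  then show ?case
    using differentiable_imp_continuous_on[of f S] differentiable_at_imp_differentiable_on by auto
next
  case (Suc k)
  then show ?case by (metis Ck_on.simps(2))
qed

lemma Ck_on_SucD:
  assumes "Ck_on (Suc k) S f"
  shows "x \<in> S \<Longrightarrow> (f has_derivative frechet_derivative f (at x)) (at x)"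
    and "Ck_on k S (\<lambda>x. frechet_derivative f (at x) v)"
  using assms frechet_derivative_works by auto

lemma Ck_on_subset: "Ck_on k S f \<Longrightarrow> T \<subseteq> S \<Longrightarrow> Ck_on k T f"
  by (induction k arbitrary: f) (auto intro: continuous_on_subset)

lemma Ck_on_const: "open S \<Longrightarrow> Ck_on k S (\<lambda>x. c)"
  by (induction k arbitrary: c) (auto intro: Ck_on_SucI[where D = "\<lambda>x v. 0"])

lemma Ck_on_linear_comp:
  assumes "bounded_linear L" "open S"
  shows "Ck_on k S f \<Longrightarrow> Ck_on k S (\<lambda>x. L (f x))"
proof (induction k arbitrary: f)
  case 0
  then show ?case using bounded_linear.continuous_on[OF assms(1)] by auto
next
  case (Suc k)
  show ?case
    by (rule Ck_on_SucI[OF assms(2) bounded_linear.has_derivative[OF assms(1) Ck_on_SucD(1)[OF Suc.prems]]])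
      (auto intro: Suc.IH Ck_on_SucD(2)[OF Suc.prems])
qed

lemma Ck_on_linear:
  assumes "bounded_linear L" "open S"
  shows "Ck_on k S L"
proof (cases k)
  case 0
  then show ?thesis using linear_continuous_on[OF assms(1)] by simp
next
  case (Suc m)
  then show ?thesis
    using Ck_on_SucI[OF assms(2) bounded_linear_imp_has_derivative[OF assms(1)]] Ck_on_const[OF assms(2)] by blast
qed

lemma Ck_on_add:
  assumes "open S"
  shows "Ck_on k S f \<Longrightarrow> Ck_on k S g \<Longrightarrow> Ck_on k S (\<lambda>x. f x + g x)"
proof (induction k arbitrary: f g)
  case 0
  then show ?case by (auto intro: continuous_on_add)
next
  case (Suc k)
  show ?case
    by (rule Ck_on_SucI[OF assms has_derivative_add[OF Ck_on_SucD(1)[OF Suc.prems(1)] Ck_on_SucD(1)[OF Suc.prems(2)]]])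
      (auto intro: Suc.IH Ck_on_SucD(2)[OF Suc.prems(1)] Ck_on_SucD(2)[OF Suc.prems(2)])
qed

lemma Ck_on_mult:
  fixes f g :: "'a::real_normed_vector \<Rightarrow> 'b::real_normed_algebra"
  assumes "open S"
  shows "Ck_on k S f \<Longrightarrow> Ck_on k S g \<Longrightarrow> Ck_on k S (\<lambda>x. f x * g x)"
proof (induction k arbitrary: f g)
  case 0
  then show ?case by (auto intro: continuous_on_mult)
next
  case (Suc k)
  show ?case
    by (rule Ck_on_SucI[OF assms has_derivative_mult[OF Ck_on_SucD(1)[OF Suc.prems(1)] Ck_on_SucD(1)[OF Suc.prems(2)]]])
      (auto intro!: Ck_on_add[OF assms] Suc.IH Ck_on_SucD(2)[OF Suc.prems(1)] Ck_on_SucD(2)[OF Suc.prems(2)]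
        Ck_on_Suc_imp[OF Suc.prems(1)] Ck_on_Suc_imp[OF Suc.prems(2)])
qed

lemma Ck_on_inverse:
  fixes f :: "'a::real_normed_vector \<Rightarrow> 'b::real_normed_field"
  assumes "open S" "Ck_on k S f" "\<And>x. x \<in> S \<Longrightarrow> f x \<noteq> 0"
  shows "Ck_on k S (\<lambda>x. inverse (f x))"
  using assms(2)
proof (induction k)
  case 0
  then show ?case using assms(3) by (auto intro: continuous_on_inverse)
next
  case (Suc k)
  \<comment> \<open>The derivative of the inverse contains the inverse itself, but only to order
    \<open>k\<close>, which the induction hypothesis supplies.\<close>
  have "Ck_on k S (\<lambda>x. inverse (f x))" using Suc Ck_on_Suc_imp by blast
  moreover have "Ck_on k S (\<lambda>x. - frechet_derivative f (at x) v)" for v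
    using Ck_on_linear_comp[OF bounded_linear_minus[OF bounded_linear_ident] assms(1) Ck_on_SucD(2)[OF Suc.prems]] .
  ultimately have "Ck_on k S (\<lambda>x. (- frechet_derivative f (at x) v) * (inverse (f x) * inverse (f x)))" for v
    using assms(1) by (intro Ck_on_mult) auto
  then have "Ck_on k S (\<lambda>x. - (inverse (f x) * frechet_derivative f (at x) v * inverse (f x)))" for v
    by (simp add: mult_ac)
  then show ?case
    by (intro Ck_on_SucI[OF assms(1) Deriv.has_derivative_inverse[OF _ Ck_on_SucD(1)[OF Suc.prems]]])
      (use assms(3) in auto)
qed

lemma smooth_on_subset: "smooth_on S f \<Longrightarrow> T \<subseteq> S \<Longrightarrow> smooth_on T f"
  by (auto simp: smooth_on_def intro: Ck_on_subset)

lemma smooth_on_const: "open S \<Longrightarrow> smooth_on S (\<lambda>x. c)"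
  by (simp add: smooth_on_def Ck_on_const)

lemma smooth_on_linear: "bounded_linear L \<Longrightarrow> open S \<Longrightarrow> smooth_on S L"
  by (simp add: smooth_on_def Ck_on_linear)

lemma smooth_on_linear_comp:
  "bounded_linear L \<Longrightarrow> open S \<Longrightarrow> smooth_on S f \<Longrightarrow> smooth_on S (\<lambda>x. L (f x))"
  by (simp add: smooth_on_def Ck_on_linear_comp)

lemma smooth_on_add: "open S \<Longrightarrow> smooth_on S f \<Longrightarrow> smooth_on S g \<Longrightarrow> smooth_on S (\<lambda>x. f x + g x)"
  by (simp add: smooth_on_def Ck_on_add)

lemma smooth_on_diff:
  assumes "open S" "smooth_on S f" "smooth_on S g"
  shows "smooth_on S (\<lambda>x. f x - g x)"
  using smooth_on_add[OF assms(1,2) smooth_on_linear_comp[OF bounded_linear_minus[OF bounded_linear_ident] assms(1,3)]]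
  by simp

lemma smooth_on_mult:
  fixes f g :: "'a::real_normed_vector \<Rightarrow> 'b::real_normed_algebra"
  shows "open S \<Longrightarrow> smooth_on S f \<Longrightarrow> smooth_on S g \<Longrightarrow> smooth_on S (\<lambda>x. f x * g x)"
  by (simp add: smooth_on_def Ck_on_mult)

lemma smooth_on_inverse:
  fixes f :: "'a::real_normed_vector \<Rightarrow> 'b::real_normed_field"
  shows "open S \<Longrightarrow> smooth_on S f \<Longrightarrow> (\<And>x. x \<in> S \<Longrightarrow> f x \<noteq> 0) \<Longrightarrow> smooth_on S (\<lambda>x. inverse (f x))"
  by (simp add: smooth_on_def Ck_on_inverse)

lemma smooth_on_sum:
  "open S \<Longrightarrow> (\<And>i. i \<in> I \<Longrightarrow> smooth_on S (f i)) \<Longrightarrow> smooth_on S (\<lambda>x. \<Sum>i\<in>I. f i x)"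
  by (induction I rule: infinite_finite_induct) (auto intro: smooth_on_const smooth_on_add)

lemma smooth_on_prod:
  fixes f :: "'i \<Rightarrow> 'a::real_normed_vector \<Rightarrow> 'b::{real_normed_algebra,comm_ring_1}"
  shows "open S \<Longrightarrow> (\<And>i. i \<in> I \<Longrightarrow> smooth_on S (f i)) \<Longrightarrow> smooth_on S (\<lambda>x. \<Prod>i\<in>I. f i x)"
  by (induction I rule: infinite_finite_induct) (auto intro: smooth_on_const smooth_on_mult)

lemma smooth_on_power:
  fixes f :: "'a::real_normed_vector \<Rightarrow> 'b::{real_normed_algebra,comm_ring_1}"
  shows "open S \<Longrightarrow> smooth_on S f \<Longrightarrow> smooth_on S (\<lambda>x. f x ^ n)"
  by (induction n) (auto intro: smooth_on_const smooth_on_mult)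

text \<open>The real derivative of \<open>h\<close> is multiplication by \<open>deriv h\<close>,
  which is again holomorphic, so the induction reproduces its own hypothesis.\<close>

lemma smooth_on_holomorphic:
  fixes h :: "complex \<Rightarrow> complex"
  assumes "open S" "h holomorphic_on S"
  shows "smooth_on S h"
proof -
  have "Ck_on k S h" for k
    using assms(2)
  proof (induction k arbitrary: h)
    case 0
    then show ?case by (simp add: holomorphic_on_imp_continuous_on)
  next
    case (Suc k)
    have "Ck_on k S (deriv h)"
      using Suc.prems assms(1) by (intro Suc.IH holomorphic_deriv)
    then have *: "Ck_on k S (\<lambda>x. deriv h x * v)" for v
      using Ck_on_mult[OF assms(1)] Ck_on_const[OF assms(1)] by blast
    have "(h has_derivative (\<lambda>v. deriv h x * v)) (at x)" if "x \<in> S" for x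
      using holomorphic_derivI[OF Suc.prems assms(1) that] by (simp add: has_field_derivative_def)
    then show ?case using * by (intro Ck_on_SucI[OF assms(1), where D = "\<lambda>x v. deriv h x * v"]) auto
  qed
  then show ?thesis by (simp add: smooth_on_def)
qed

lemma smooth_on_imp_differentiable: "smooth_on S f \<Longrightarrow> x \<in> S \<Longrightarrow> f differentiable (at x)"
  unfolding smooth_on_def by (metis Ck_on.simps(2))

lemma smooth_on_fst:
  fixes S :: "'a::real_normed_vector set" and f :: "'a \<Rightarrow> 'c::real_normed_vector"
  assumes "open S" "smooth_on S f"
  shows "smooth_on (S \<times> (UNIV :: 'b::real_normed_vector set)) (\<lambda>x. f (fst x))"
proof -
  have op: "open (S \<times> (UNIV :: 'b set))" using assms(1) by (simp add: open_Times)
  have "Ck_on k (S \<times> (UNIV :: 'b set)) (\<lambda>x. f (fst x))" if "Ck_on k S f" for k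
    using that
  proof (induction k arbitrary: f)
    case 0
    then show ?case by (auto intro!: continuous_on_compose2[of S f] continuous_intros)
  next
    case (Suc k)
    show ?case
    proof (rule Ck_on_SucI[OF op])
      fix x assume "x \<in> S \<times> (UNIV :: 'b set)"
      then show "((\<lambda>x. f (fst x)) has_derivative (\<lambda>v. frechet_derivative f (at (fst x)) (fst v))) (at x)"
        by (intro has_derivative_compose[OF has_derivative_fst[OF has_derivative_ident] Ck_on_SucD(1)[OF Suc.prems]]) auto
    next
      fix v :: "'a \<times> 'b"
      show "Ck_on k (S \<times> (UNIV :: 'b set)) (\<lambda>x. frechet_derivative f (at (fst x)) (fst v))"
        using Suc.IH[OF Ck_on_SucD(2)[OF Suc.prems]] .
    qed
  qed
  then show ?thesis using assms(2) by (simp add: smooth_on_def)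
qed

section \<open>Nets, moduli of continuity and weighted means\<close>

text \<open>Comparison with a telescoping series bounds the sum over each half-line by 2.\<close>

lemma sum_inverse_squares_int_le:
  assumes "finite (U :: int set)"
  shows "(\<Sum>u\<in>U. 1 / (1 + \<bar>real_of_int u\<bar>)\<^sup>2) \<le> 4"
proof -
  have nat: "(\<Sum>n\<le>N. 1 / (1 + real n)\<^sup>2) \<le> 2 - 1 / (1 + real N)" for N
  proof (induction N)
    case (Suc N)
    have "1 / (2 + real N)\<^sup>2 \<le> 1 / ((1 + real N) * (2 + real N))"
      by (intro divide_left_mono) (auto simp: power2_eq_square)
    also have "\<dots> = 1 / (1 + real N) - 1 / (2 + real N)" by (simp add: field_simps)
    finally show ?case using Suc by simp
  qed simp
  obtain N :: nat where N: "\<And>u. u \<in> U \<Longrightarrow> \<bar>u\<bar> \<le> int N"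
  proof
    fix u assume "u \<in> U"
    then have "\<bar>u\<bar> \<le> Max (insert 0 (abs ` U))" using assms by (intro Max_ge) auto
    moreover have "0 \<le> Max (insert 0 (abs ` U))" using assms by (intro Max_ge) auto
    ultimately show "\<bar>u\<bar> \<le> int (nat (Max (insert 0 (abs ` U))))" by simp
  qed
  let ?g = "\<lambda>u::int. 1 / (1 + \<bar>real_of_int u\<bar>)\<^sup>2"
  have "U \<subseteq> int ` {..N} \<union> (\<lambda>n. - int n) ` {..N}"
  proof
    fix u assume "u \<in> U"
    then have "u = int (nat \<bar>u\<bar>) \<or> u = - int (nat \<bar>u\<bar>)" "nat \<bar>u\<bar> \<le> N" using N[of u] by auto
    then show "u \<in> int ` {..N} \<union> (\<lambda>n. - int n) ` {..N}" by blast
  qed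
  then have "sum ?g U \<le> sum ?g (int ` {..N} \<union> (\<lambda>n. - int n) ` {..N})"
    by (intro sum_mono2) auto
  also have "\<dots> \<le> sum ?g (int ` {..N}) + sum ?g ((\<lambda>n. - int n) ` {..N})"
    by (subst sum_Un) (auto intro: sum_nonneg)
  also have "\<dots> = (\<Sum>n\<le>N. 1 / (1 + real n)\<^sup>2) + (\<Sum>n\<le>N. 1 / (1 + real n)\<^sup>2)"
    by (simp add: sum.reindex inj_on_def)
  also have "\<dots> \<le> 2 + 2" using nat[of N] by (intro add_mono) (smt (verit) divide_nonneg_nonneg of_nat_0_le_iff)+
  finally show ?thesis by simp
qed

text \<open>One point of \<open>T\<close> is kept in every non-empty cell of a square grid of mesh
  \<open>d\<close>. Distinct points lie in distinct cells, and the fourth power splits into one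
  square per coordinate, so a product of two one-dimensional sums dominates. The bound 256 = 16 * 4
  * 4 depends neither on \<open>d\<close> nor on \<open>a\<close>; the approximation rests on
  this.\<close>

lemma grid_net:
  fixes T :: "complex set"
  assumes "bounded T" "0 < d"
  obtains I where "finite I" "I \<subseteq> T" "\<And>a. a \<in> T \<Longrightarrow> \<exists>i\<in>I. norm (i - a) \<le> 2 * d"
    "\<And>a. (\<Sum>i\<in>I. 1 / (1 + norm (i - a) / d) ^ 4) \<le> 256"
proof -
  define c where "c = (\<lambda>x::complex. (\<lfloor>Re x / d\<rfloor>, \<lfloor>Im x / d\<rfloor>))"
  obtain B where B: "\<And>x. x \<in> T \<Longrightarrow> norm x \<le> B" using assms(1) by (auto simp: bounded_iff)
  have fin: "finite (c ` T)"
  proof (rule finite_subset)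
    have bd: "\<lfloor>- B / d\<rfloor> \<le> \<lfloor>x / d\<rfloor> \<and> \<lfloor>x / d\<rfloor> \<le> \<lfloor>B / d\<rfloor>" if "\<bar>x\<bar> \<le> B" for x
      using that assms(2) by (intro conjI floor_mono divide_right_mono) auto
    show "c ` T \<subseteq> {\<lfloor>- B / d\<rfloor>..\<lfloor>B / d\<rfloor>} \<times> {\<lfloor>- B / d\<rfloor>..\<lfloor>B / d\<rfloor>}"
    proof (rule image_subsetI)
      fix x assume "x \<in> T"
      then have "\<bar>Re x\<bar> \<le> B" "\<bar>Im x\<bar> \<le> B"
        using B[of x] abs_Re_le_cmod[of x] abs_Im_le_cmod[of x] by auto
      then show "c x \<in> {\<lfloor>- B / d\<rfloor>..\<lfloor>B / d\<rfloor>} \<times> {\<lfloor>- B / d\<rfloor>..\<lfloor>B / d\<rfloor>}"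
        using bd by (simp add: c_def)
    qed
  qed auto
  define ch where "ch = (\<lambda>q. SOME x. x \<in> T \<and> c x = q)"
  have ch: "ch q \<in> T \<and> c (ch q) = q" if "q \<in> c ` T" for q
    unfolding ch_def by (rule someI_ex) (use that in auto)
  define I where "I = ch ` (c ` T)"
  have cI: "inj_on c I" unfolding I_def using ch by (auto simp: inj_on_def)
  show thesis
  proof (rule that[of I])
    show I: "finite I" "I \<subseteq> T" using fin ch by (auto simp: I_def)
  next
    fix a assume a: "a \<in> T"
    let ?i = "ch (c a)"
    have "c ?i = c a" using ch a by auto
    then have fl: "\<lfloor>Re ?i / d\<rfloor> = \<lfloor>Re a / d\<rfloor>" "\<lfloor>Im ?i / d\<rfloor> = \<lfloor>Im a / d\<rfloor>" by (auto simp: c_def)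
    have close: "\<bar>x - y\<bar> \<le> d" if "\<lfloor>x / d\<rfloor> = \<lfloor>y / d\<rfloor>" for x y
    proof -
      have "\<bar>x / d - y / d\<bar> \<le> 1" using that by linarith
      then show ?thesis using assms(2) by (simp add: field_simps abs_le_iff)
    qed
    have "norm (?i - a) \<le> \<bar>Re (?i - a)\<bar> + \<bar>Im (?i - a)\<bar>" by (rule cmod_le)
    also have "\<dots> \<le> 2 * d" using close[OF fl(1)] close[OF fl(2)] by simp
    finally show "\<exists>i\<in>I. norm (i - a) \<le> 2 * d" using a by (auto simp: I_def)
  next
    fix a
    define p where "p = \<lfloor>Re a / d\<rfloor>"
    define q where "q = \<lfloor>Im a / d\<rfloor>"
    let ?g = "\<lambda>u::int. 1 / (1 + \<bar>real_of_int u\<bar>)\<^sup>2"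
    define k where "k = (\<lambda>i. (fst (c i) - p, snd (c i) - q))"
    have inj: "inj_on k I" using cI by (auto simp: inj_on_def k_def prod_eq_iff)
    have finI: "finite I" using fin by (simp add: I_def)
    \<comment> \<open>Rounding down changes a difference by at most 1 in units of \<open>d\<close>,
      and \<open>2 + n / d \<le> 2 * (1 + n / d)\<close> accounts for the factor 1/2.\<close>
    have coord: "(1 + \<bar>real_of_int (\<lfloor>x / d\<rfloor> - \<lfloor>y / d\<rfloor>)\<bar>) / 2 \<le> 1 + n / d"
      if "\<bar>x - y\<bar> \<le> n" for x y n
    proof -
      have "\<bar>x / d - y / d\<bar> \<le> n / d"
        using that assms(2) by (simp add: divide_right_mono flip: diff_divide_distrib)
      moreover have "0 \<le> n / d" using that assms(2) by auto
      moreover have "\<bar>real_of_int (\<lfloor>x / d\<rfloor> - \<lfloor>y / d\<rfloor>)\<bar> \<le> 1 + \<bar>x / d - y / d\<bar>" by linarith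
      ultimately show ?thesis by (simp add: field_simps) linarith
    qed
    have cell: "1 / (1 + norm (i - a) / d) ^ 4 \<le> 16 * (?g (fst (k i)) * ?g (snd (k i)))" for i
    proof -
      let ?N = "1 + norm (i - a) / d"
      let ?U = "1 + \<bar>real_of_int (fst (k i))\<bar>" and ?V = "1 + \<bar>real_of_int (snd (k i))\<bar>"
      have U: "?U / 2 \<le> ?N" using coord[of "Re i" "Re a" "norm (i - a)"] abs_Re_le_cmod[of "i - a"]
        by (simp add: k_def c_def p_def)
      have V: "?V / 2 \<le> ?N" using coord[of "Im i" "Im a" "norm (i - a)"] abs_Im_le_cmod[of "i - a"]
        by (simp add: k_def c_def q_def)
      have "(?U / 2)\<^sup>2 * (?V / 2)\<^sup>2 \<le> ?N\<^sup>2 * ?N\<^sup>2"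
        using U V by (intro mult_mono power_mono) auto
      then have le: "?U\<^sup>2 * ?V\<^sup>2 / 16 \<le> ?N ^ 4"
        by (simp add: power_divide flip: power_add)
      have "1 / ?N ^ 4 \<le> 1 / (?U\<^sup>2 * ?V\<^sup>2 / 16)"
        using le assms(2) by (intro divide_left_mono mult_pos_pos divide_pos_pos zero_less_power) (auto intro: add_pos_nonneg)
      then show ?thesis by simp
    qed
    have "(\<Sum>i\<in>I. 1 / (1 + norm (i - a) / d) ^ 4) \<le> (\<Sum>i\<in>I. 16 * (?g (fst (k i)) * ?g (snd (k i))))"
      by (intro sum_mono cell)
    also have "\<dots> = 16 * (\<Sum>x\<in>k ` I. ?g (fst x) * ?g (snd x))"
      by (simp add: sum.reindex[OF inj] sum_distrib_left)
    also have "\<dots> \<le> 16 * (\<Sum>x\<in>(fst ` k ` I) \<times> (snd ` k ` I). ?g (fst x) * ?g (snd x))"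
      proof -
      have "k ` I \<subseteq> fst ` k ` I \<times> snd ` k ` I" by (metis subset_fst_snd)
      then show ?thesis using finI by (intro mult_left_mono sum_mono2) auto
    qed
    also have "\<dots> = 16 * (sum ?g (fst ` k ` I) * sum ?g (snd ` k ` I))"
      by (simp add: sum_product sum.cartesian_product case_prod_beta)
    also have "\<dots> \<le> 16 * (4 * 4)"
      using finI by (intro mult_left_mono mult_mono sum_inverse_squares_int_le sum_nonneg) auto
    finally show "(\<Sum>i\<in>I. 1 / (1 + norm (i - a) / d) ^ 4) \<le> 256" by simp
  qed
qed

text \<open>A substitute for a Lipschitz bound: below the scale \<open>s\<close> of uniform
  continuity the error is \<open>e\<close>, and beyond it the crude bound \<open>2 * B\<close> is at
  most \<open>2 * B / s\<close> times the distance. The affine form can be summed against decaying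
  weights.\<close>

lemma uniformly_continuous_modulus:
  fixes h :: "'a::metric_space \<Rightarrow> 'b::real_normed_vector"
  assumes "compact S" "continuous_on S h" "0 < e"
  obtains K where "0 \<le> K" "\<And>x y. x \<in> S \<Longrightarrow> y \<in> S \<Longrightarrow> norm (h x - h y) \<le> e + K * dist x y"
proof -
  obtain s where s: "0 < s" "\<And>x y. x \<in> S \<Longrightarrow> y \<in> S \<Longrightarrow> dist y x < s \<Longrightarrow> dist (h y) (h x) < e"
    using compact_uniformly_continuous[OF assms(2,1)] assms(3) unfolding uniformly_continuous_on_def by metis
  obtain B where B: "0 < B" "\<And>x. x \<in> S \<Longrightarrow> norm (h x) \<le> B"
    using compact_imp_bounded[OF compact_continuous_image[OF assms(2,1)]] by (auto simp: bounded_pos)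
  show thesis
  proof (rule that[of "2 * B / s"])
    fix x y assume xy: "x \<in> S" "y \<in> S"
    show "norm (h x - h y) \<le> e + 2 * B / s * dist x y"
    proof (cases "dist x y < s")
      case True
      then have "norm (h x - h y) < e" using s(2)[of y x] xy by (simp add: dist_norm)
      moreover have "0 \<le> 2 * B / s * dist x y" using B(1) s(1) by simp
      ultimately show ?thesis by linarith
    next
      case False
      have "norm (h x - h y) \<le> 2 * B" using norm_triangle_ineq4[of "h x" "h y"] B(2)[OF xy(1)] B(2)[OF xy(2)] by linarith
      also have "\<dots> = 2 * B / s * s" using s(1) by simp
      also have "\<dots> \<le> 2 * B / s * dist x y" using False B(1) s(1) by (intro mult_left_mono) auto
      finally show ?thesis using assms(3) by linarith
    qed
  qed (use B s in auto)
qed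

text \<open>With \<open>L i\<close> the logarithmic derivative of \<open>u i\<close>, the normalised
  weight has logarithmic derivative \<open>L j\<close> minus the weighted mean of the
  \<open>L i\<close>. Only differences \<open>L j - L i\<close> enter, which is why estimates for
  ratios of leaves suffice.\<close>

lemma has_derivative_weight:
  fixes u :: "'i \<Rightarrow> 'a::real_normed_vector \<Rightarrow> complex"
  assumes "\<And>i. i \<in> I \<Longrightarrow> (u i has_derivative (\<lambda>v. u i z * L i v)) (at z)"
    and S: "(\<Sum>i\<in>I. u i z) \<noteq> 0" and "j \<in> I"
  shows "((\<lambda>x. u j x / (\<Sum>i\<in>I. u i x)) has_derivative
    (\<lambda>v. u j z / (\<Sum>i\<in>I. u i z) * (\<Sum>i\<in>I. u i z / (\<Sum>i\<in>I. u i z) * (L j v - L i v)))) (at z)"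
proof -
  define T where "T = (\<Sum>i\<in>I. u i z)"
  have T: "T \<noteq> 0" using S by (simp add: T_def)
  have D: "((\<lambda>x. u j x / (\<Sum>i\<in>I. u i x)) has_derivative
    (\<lambda>v. - u j z * (inverse T * (\<Sum>i\<in>I. u i z * L i v) * inverse T) + u j z * L j v / T)) (at z)"
    unfolding T_def by (rule has_derivative_divide[OF assms(1)[OF assms(3)] has_derivative_sum[OF assms(1)] S])
  have "- u j z * (inverse T * (\<Sum>i\<in>I. u i z * L i v) * inverse T) + u j z * L j v / T =
     u j z / T * (\<Sum>i\<in>I. u i z / T * (L j v - L i v))" for v
  proof -
    have "(\<Sum>i\<in>I. u i z / T * (L j v - L i v)) = (\<Sum>i\<in>I. u i z * L j v / T - u i z * L i v / T)"
      by (simp add: algebra_simps diff_divide_distrib)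
    also have "\<dots> = T * L j v / T - (\<Sum>i\<in>I. u i z * L i v) / T"
      by (simp add: sum_subtractf T_def sum_distrib_right sum_divide_distrib)
    finally have eq: "(\<Sum>i\<in>I. u i z / T * (L j v - L i v)) = L j v - (\<Sum>i\<in>I. u i z * L i v) / T"
      using T by simp
    show ?thesis unfolding eq using T by (simp add: divide_simps) (simp add: algebra_simps)
  qed
  with D show ?thesis by (simp add: T_def)
qed

text \<open>The weights sum to 1, so their derivatives sum to 0. Hence \<open>f z\<close> may be
  subtracted from every \<open>P i z\<close> and \<open>Df v\<close> from every
  \<open>DP i v\<close>, and the derivatives of the weights meet only the small differences
  \<open>P i z - f z\<close>.\<close>

lemma weighted_mean_C1_bound:
  fixes \<psi> P :: "'i \<Rightarrow> 'a::real_normed_vector \<Rightarrow> complex"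
  assumes "finite I" "open U" "z \<in> U"
    and one: "\<And>x. x \<in> U \<Longrightarrow> (\<Sum>i\<in>I. \<psi> i x) = 1"
    and d\<psi>: "\<And>i. i \<in> I \<Longrightarrow> (\<psi> i has_derivative D\<psi> i) (at z)"
    and dP: "\<And>i. i \<in> I \<Longrightarrow> (P i has_derivative DP i) (at z)"
    and df: "(f has_derivative Df) (at z)"
    and A: "\<And>i. i \<in> I \<Longrightarrow> norm (\<psi> i z) \<le> A i"
    and B: "\<And>i v. i \<in> I \<Longrightarrow> norm (D\<psi> i v) \<le> A' i * norm v"
    and X: "\<And>i. i \<in> I \<Longrightarrow> norm (P i z - f z) \<le> X i"
    and Y: "\<And>i v. i \<in> I \<Longrightarrow> norm (DP i v - Df v) \<le> Y i * norm v"
  shows "norm ((\<Sum>i\<in>I. \<psi> i z * P i z) - f z) \<le> (\<Sum>i\<in>I. A i * X i)"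
    and "norm (frechet_derivative (\<lambda>x. (\<Sum>i\<in>I. \<psi> i x * P i x)) (at z) v - Df v)
           \<le> (\<Sum>i\<in>I. A' i * X i + A i * Y i) * norm v"
proof -
  have "(\<Sum>i\<in>I. \<psi> i z * P i z) - f z = (\<Sum>i\<in>I. \<psi> i z * P i z) - (\<Sum>i\<in>I. \<psi> i z) * f z"
    using one[OF assms(3)] by simp
  also have "\<dots> = (\<Sum>i\<in>I. \<psi> i z * (P i z - f z))"
    by (simp only: sum_distrib_right sum_subtractf right_diff_distrib)
  finally have "norm ((\<Sum>i\<in>I. \<psi> i z * P i z) - f z) = norm (\<Sum>i\<in>I. \<psi> i z * (P i z - f z))" by simp
  also have "\<dots> \<le> (\<Sum>i\<in>I. A i * X i)"
    by (rule sum_norm_le) (auto simp: norm_mult intro!: mult_mono A X order_trans[OF norm_ge_zero A])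
  finally show "norm ((\<Sum>i\<in>I. \<psi> i z * P i z) - f z) \<le> (\<Sum>i\<in>I. A i * X i)" .
  have D: "((\<lambda>x. (\<Sum>i\<in>I. \<psi> i x * P i x)) has_derivative
     (\<lambda>v. \<Sum>i\<in>I. \<psi> i z * DP i v + D\<psi> i v * P i z)) (at z)"
    by (intro has_derivative_sum has_derivative_mult d\<psi> dP)
  have "((\<lambda>x. \<Sum>i\<in>I. \<psi> i x) has_derivative (\<lambda>v. \<Sum>i\<in>I. D\<psi> i v)) (at z)"
    by (intro has_derivative_sum d\<psi>)
  then have "((\<lambda>x. 1) has_derivative (\<lambda>v. \<Sum>i\<in>I. D\<psi> i v)) (at z)"
    by (rule has_derivative_transform_within_open[OF _ assms(2,3) one])
  then have "(\<lambda>v. \<Sum>i\<in>I. D\<psi> i v) = (\<lambda>v. 0)"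
    using has_derivative_const has_derivative_unique by blast
  then have zero: "(\<Sum>i\<in>I. D\<psi> i v) = 0" by meson
  have "(\<Sum>i\<in>I. \<psi> i z * DP i v + D\<psi> i v * P i z) - Df v =
     (\<Sum>i\<in>I. \<psi> i z * DP i v + D\<psi> i v * P i z) - (\<Sum>i\<in>I. \<psi> i z) * Df v - (\<Sum>i\<in>I. D\<psi> i v) * f z"
    using one[OF assms(3)] zero by simp
  also have "\<dots> = (\<Sum>i\<in>I. D\<psi> i v * (P i z - f z) + \<psi> i z * (DP i v - Df v))"
    by (simp only: sum_distrib_right sum_subtractf sum.distrib right_diff_distrib) simp
  finally have "norm (frechet_derivative (\<lambda>x. (\<Sum>i\<in>I. \<psi> i x * P i x)) (at z) v - Df v) =
     norm (\<Sum>i\<in>I. D\<psi> i v * (P i z - f z) + \<psi> i z * (DP i v - Df v))"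
    by (simp add: frechet_derivative_at[OF D, symmetric])
  also have "\<dots> \<le> (\<Sum>i\<in>I. (A' i * norm v) * X i + A i * (Y i * norm v))"
    by (intro sum_norm_le norm_triangle_le add_mono)
      (auto simp: norm_mult intro!: mult_mono A B X Y order_trans[OF norm_ge_zero A] order_trans[OF norm_ge_zero B])
  also have "\<dots> = (\<Sum>i\<in>I. A' i * X i + A i * Y i) * norm v"
    unfolding sum_distrib_right by (intro sum.cong refl) (simp add: algebra_simps)
  finally show "norm (frechet_derivative (\<lambda>x. (\<Sum>i\<in>I. \<psi> i x * P i x)) (at z) v - Df v)
           \<le> (\<Sum>i\<in>I. A' i * X i + A i * Y i) * norm v" .
qed

section \<open>Smooth approximation in one complex variable\<close>

text \<open>The derivative is written as the function times its logarithmic derivative, the form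
  that \<open>has_derivative_weight\<close> expects.\<close>

lemma has_derivative_inverse_power:
  fixes q :: "'a::real_normed_vector \<Rightarrow> complex"
  assumes "(q has_derivative Dq) (at z)" "q z \<noteq> 0"
  shows "((\<lambda>x. inverse (q x ^ m)) has_derivative
    (\<lambda>v. inverse (q z ^ m) * (- (of_nat m * (Dq v / q z))))) (at z)"
proof -
  have "((\<lambda>x. inverse (q x ^ m)) has_derivative
    (\<lambda>v. - (inverse (q z ^ m) * (of_nat m * Dq v * q z ^ (m - 1)) * inverse (q z ^ m)))) (at z)"
    by (rule Deriv.has_derivative_inverse[OF _ has_derivative_power[OF assms(1)]]) (use assms(2) in simp)
  moreover have "- (inverse (q z ^ m) * (of_nat m * Dq v * q z ^ (m - 1)) * inverse (q z ^ m)) =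
     inverse (q z ^ m) * (- (of_nat m * (Dq v / q z)))" for v
    using assms(2) by (cases m) (auto simp: field_simps)
  ultimately show ?thesis by simp
qed

text \<open>By \<open>e + K * a \<le> (e + K * d) * (1 + a / d)\<close>, the growth of the error
  with the distance \<open>a\<close> costs one power of decay; what remains is the summand of
  \<open>grid_net\<close>.\<close>

lemma weighted_error_bound:
  fixes e K d a :: real
  assumes "0 \<le> e" "0 \<le> K" "0 < d" "0 \<le> a"
  shows "1 / (1 + a / d) ^ 5 * (e + K * a) \<le> (e + K * d) * (1 / (1 + a / d) ^ 4)"
proof -
  have p: "0 < 1 + a / d" using assms by (simp add: add_pos_nonneg)
  have "e + K * a = e + K * d * (a / d)" using assms by simp
  also have "\<dots> \<le> (e + K * d) * (1 + a / d)"
    using assms by (simp add: algebra_simps)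
  finally have "1 / (1 + a / d) ^ 5 * (e + K * a) \<le> 1 / (1 + a / d) ^ 5 * ((e + K * d) * (1 + a / d))"
    using p by (intro mult_left_mono) auto
  also have "\<dots> = (e + K * d) * (1 / (1 + a / d) ^ 4)"
    using p by (simp add: divide_simps power_numeral_reduce)
  finally show ?thesis .
qed

text \<open>A sum of positive terms is at least any one of them. With \<open>l\<close> a nearby
  point, normalisation becomes a ratio of two weights.\<close>

lemma norm_weight_le:
  fixes x :: "'i \<Rightarrow> real"
  assumes "finite I" "\<And>i. i \<in> I \<Longrightarrow> 0 < x i" "l \<in> I" "j \<in> I"
  shows "norm (complex_of_real (x j) / (\<Sum>i\<in>I. complex_of_real (x i))) \<le> x j / x l"
    and "(\<Sum>i\<in>I. complex_of_real (x i)) \<noteq> 0"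
proof -
  have le: "x l \<le> (\<Sum>i\<in>I. x i)"
    using assms by (intro member_le_sum) (auto simp: less_imp_le)
  have pos: "0 < x l" "0 < x j" using assms by auto
  have eq: "(\<Sum>i\<in>I. complex_of_real (x i)) = of_real (\<Sum>i\<in>I. x i)" by simp
  show "(\<Sum>i\<in>I. complex_of_real (x i)) \<noteq> 0"
    unfolding eq using le pos by (simp del: of_real_sum)
  have "norm (complex_of_real (x j) / (\<Sum>i\<in>I. complex_of_real (x i))) = x j / (\<Sum>i\<in>I. x i)"
    unfolding eq using le pos by (simp add: norm_divide del: of_real_sum)
  also have "\<dots> \<le> x j / x l" using le pos by (intro divide_left_mono) (auto intro: mult_pos_pos)
  finally show "norm (complex_of_real (x j) / (\<Sum>i\<in>I. complex_of_real (x i))) \<le> x j / x l" .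
qed

text \<open>The weights \<open>1 / (d\<^sup>2 + |z - k|\<^sup>2)\<^sup>3\<close>, normalised over a \<open>d\<close>-net, localise to scale \<open>d\<close> while their
  logarithmic derivatives are of size \<open>1 / d\<close>.\<close>

lemma net_weights:
  fixes d :: real
  assumes "finite I" "0 < d" "l \<in> I" "norm (l - z) \<le> 2 * d" "j \<in> I"
  defines "u \<equiv> \<lambda>k x. inverse ((of_real (d\<^sup>2) + (x - k) * cnj (x - k)) ^ 3)"
  shows "(\<Sum>i\<in>I. u i x) \<noteq> 0"
    and "norm (u j z / (\<Sum>i\<in>I. u i z)) \<le> 1000 / (1 + norm (j - z) / d) ^ 6"
    and "\<exists>D. ((\<lambda>x. u j x / (\<Sum>i\<in>I. u i x)) has_derivative D) (at z) \<and>
           (\<forall>v. norm (D v) \<le> 6000 / d / (1 + norm (j - z) / d) ^ 6 * norm v)"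
proof -
  define X where "X = (\<lambda>k x :: complex. 1 / (d\<^sup>2 + (norm (x - k))\<^sup>2) ^ 3)"
  have qpos: "0 < d\<^sup>2 + (norm (x - k))\<^sup>2" for x k :: complex
    using assms(2) by (simp add: add_pos_nonneg)
  have q: "of_real (d\<^sup>2) + (x - k) * cnj (x - k) = complex_of_real (d\<^sup>2 + (norm (x - k))\<^sup>2)" for x k
    by (simp only: of_real_add complex_norm_square)
  have u: "u k x = of_real (X k x)" for k x
    unfolding u_def q X_def by (simp add: divide_inverse)
  have Xpos: "0 < X k x" for k x using qpos by (simp add: X_def)
  show S: "(\<Sum>i\<in>I. u i x) \<noteq> 0" for x
    unfolding u by (rule norm_weight_le(2)) (use assms Xpos in auto)
  \<comment> \<open>The constant is \<open>10 ^ 3\<close>: a factor 5 from the nearby point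
    \<open>l\<close>, a factor 2 from \<open>(1 + y)\<^sup>2 \<le> 2 * (1 + y\<^sup>2)\<close>, and
    the exponent 3 of the weights.\<close>
  have w: "norm (u j z / (\<Sum>i\<in>I. u i z)) \<le> 1000 / (1 + norm (j - z) / d) ^ 6" if "j \<in> I" for j
  proof -
    define y where "y = norm (j - z) / d"
    have y: "0 \<le> y" using assms(2) by (simp add: y_def)
    have l: "d\<^sup>2 + (norm (z - l))\<^sup>2 \<le> 5 * d\<^sup>2"
      using power_mono[OF assms(4), of 2] by (simp add: norm_minus_commute power_mult_distrib)
    have "d\<^sup>2 + (norm (z - j))\<^sup>2 = d\<^sup>2 * (1 + y\<^sup>2)"
      using assms(2) by (simp add: y_def power_divide field_simps norm_minus_commute)
    moreover have "(1 + y)\<^sup>2 \<le> 2 * (1 + y\<^sup>2)" using sum_squares_bound[of 1 y] by (simp add: power2_eq_square algebra_simps)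
    ultimately have j: "d\<^sup>2 * ((1 + y)\<^sup>2 / 2) \<le> d\<^sup>2 + (norm (z - j))\<^sup>2"
      by (simp only:) (intro mult_left_mono, auto)
    have j0: "0 < d\<^sup>2 * ((1 + y)\<^sup>2 / 2)" using assms(2) y by simp
    have "(d\<^sup>2 + (norm (z - l))\<^sup>2) / (d\<^sup>2 + (norm (z - j))\<^sup>2) \<le> 5 * d\<^sup>2 / (d\<^sup>2 * ((1 + y)\<^sup>2 / 2))"
      using l j j0 by (intro frac_le) auto
    also have "\<dots> = 10 / (1 + y)\<^sup>2" using assms(2) by simp
    finally have le: "(d\<^sup>2 + (norm (z - l))\<^sup>2) / (d\<^sup>2 + (norm (z - j))\<^sup>2) \<le> 10 / (1 + y)\<^sup>2" .
    have "norm (u j z / (\<Sum>i\<in>I. u i z)) \<le> X j z / X l z"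
      unfolding u by (rule norm_weight_le(1)) (use assms that Xpos in auto)
    also have "\<dots> = ((d\<^sup>2 + (norm (z - l))\<^sup>2) / (d\<^sup>2 + (norm (z - j))\<^sup>2)) ^ 3"
      by (simp add: X_def power_divide)
    also have "\<dots> \<le> (10 / (1 + y)\<^sup>2) ^ 3"
      by (intro power_mono le) auto
    also have "\<dots> = 1000 / (1 + y) ^ 6" by (simp add: power_divide flip: power_mult)
    finally show ?thesis by (simp add: y_def)
  qed
  show "norm (u j z / (\<Sum>i\<in>I. u i z)) \<le> 1000 / (1 + norm (j - z) / d) ^ 6" by (rule w[OF assms(5)])
  define L where "L = (\<lambda>k v. - (of_nat 3 * (((z - k) * cnj v + v * cnj (z - k)) / (of_real (d\<^sup>2) + (z - k) * cnj (z - k)))))"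
  have D: "(u k has_derivative (\<lambda>v. u k z * L k v)) (at z)" for k
  proof -
    have "((\<lambda>x. of_real (d\<^sup>2) + (x - k) * cnj (x - k)) has_derivative (\<lambda>v. (z - k) * cnj v + v * cnj (z - k))) (at z)"
      by (auto intro!: derivative_eq_intros bounded_linear.has_derivative[OF bounded_linear_cnj])
    moreover have "of_real (d\<^sup>2) + (z - k) * cnj (z - k) \<noteq> 0"
      unfolding q of_real_eq_0_iff using qpos[of z k] by linarith
    ultimately show ?thesis unfolding u_def L_def by (rule has_derivative_inverse_power)
  qed
  \<comment> \<open>By the inequality \<open>2 * d * x \<le> d\<^sup>2 + x\<^sup>2\<close>. The
    constant 6000 of the statement is \<open>1000 * (3 + 3)\<close>.\<close>
  have L: "norm (L k v) \<le> 3 / d * norm v" for k v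
  proof -
    have "2 * d * norm (z - k) \<le> d\<^sup>2 + (norm (z - k))\<^sup>2"
      by (rule sum_squares_bound)
    then have "2 * norm (z - k) / (d\<^sup>2 + (norm (z - k))\<^sup>2) \<le> 1 / d"
      using assms(2) qpos[of z k] by (simp add: field_simps)
    then have *: "2 * norm (z - k) / (d\<^sup>2 + (norm (z - k))\<^sup>2) * norm v \<le> 1 / d * norm v"
      by (intro mult_right_mono) auto
    have "norm ((z - k) * cnj v + v * cnj (z - k)) \<le> 2 * norm (z - k) * norm v"
      by (rule norm_triangle_le) (simp add: norm_mult del: complex_cnj_diff)
    moreover have "norm (L k v) = 3 * (norm ((z - k) * cnj v + v * cnj (z - k)) / (d\<^sup>2 + (norm (z - k))\<^sup>2))"
      unfolding L_def q using qpos[of z k] by (simp only: norm_minus_cancel norm_mult norm_divide norm_of_real) simp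
    ultimately have "norm (L k v) \<le> 3 * (2 * norm (z - k) * norm v / (d\<^sup>2 + (norm (z - k))\<^sup>2))"
      using qpos[of z k] by (simp only:) (intro mult_left_mono divide_right_mono, auto)
    with * show ?thesis by simp
  qed
  show "\<exists>D. ((\<lambda>x. u j x / (\<Sum>i\<in>I. u i x)) has_derivative D) (at z) \<and>
           (\<forall>v. norm (D v) \<le> 6000 / d / (1 + norm (j - z) / d) ^ 6 * norm v)"
  proof (intro exI conjI allI)
    show "((\<lambda>x. u j x / (\<Sum>i\<in>I. u i x)) has_derivative
      (\<lambda>v. u j z / (\<Sum>i\<in>I. u i z) * (\<Sum>i\<in>I. u i z / (\<Sum>i\<in>I. u i z) * (L j v - L i v)))) (at z)"
      by (rule has_derivative_weight[OF D S assms(5)])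
    fix v
    have "(\<Sum>i\<in>I. u i z / (\<Sum>i\<in>I. u i z) * (L j v - L i v)) = L j v - (\<Sum>i\<in>I. u i z / (\<Sum>i\<in>I. u i z) * L i v)"
      using S[of z] by (simp add: right_diff_distrib sum_subtractf flip: sum_distrib_right sum_divide_distrib)
    \<comment> \<open>The weights are positive reals with sum 1, so the mean of the
      \<open>L i\<close> obeys the bound of each of them, and no factor counting the points of the
      net appears.\<close>
    moreover have "norm (\<Sum>i\<in>I. u i z / (\<Sum>i\<in>I. u i z) * L i v) \<le> 3 / d * norm v"
    proof -
      have "norm (\<Sum>i\<in>I. u i z / (\<Sum>i\<in>I. u i z) * L i v) \<le> (\<Sum>i\<in>I. X i z / (\<Sum>i\<in>I. X i z) * (3 / d * norm v))"
      proof (rule sum_norm_le)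
        fix i assume "i \<in> I"
        have "norm (u i z / (\<Sum>i\<in>I. u i z)) = X i z / (\<Sum>i\<in>I. X i z)"
          unfolding u using Xpos by (simp add: norm_divide sum_nonneg less_imp_le flip: of_real_sum)
        then show "norm (u i z / (\<Sum>i\<in>I. u i z) * L i v) \<le> X i z / (\<Sum>i\<in>I. X i z) * (3 / d * norm v)"
          using Xpos by (simp only: norm_mult) (intro mult_left_mono L divide_nonneg_nonneg sum_nonneg less_imp_le)
      qed
      also have "\<dots> = (\<Sum>i\<in>I. X i z) / (\<Sum>i\<in>I. X i z) * (3 / d * norm v)"
        by (simp only: sum_distrib_right sum_divide_distrib)
      also have "\<dots> = 3 / d * norm v"
        using S[of z] unfolding u by (simp flip: of_real_sum)
      finally show ?thesis .
    qed
    ultimately have "norm (\<Sum>i\<in>I. u i z / (\<Sum>i\<in>I. u i z) * (L j v - L i v)) \<le> 3 / d * norm v + 3 / d * norm v"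
      by (simp only:) (intro order_trans[OF norm_triangle_ineq4] add_mono L)
    then have "norm (u j z / (\<Sum>i\<in>I. u i z) * (\<Sum>i\<in>I. u i z / (\<Sum>i\<in>I. u i z) * (L j v - L i v)))
       \<le> 1000 / (1 + norm (j - z) / d) ^ 6 * (3 / d * norm v + 3 / d * norm v)"
      unfolding norm_mult using assms(2) by (intro mult_mono w assms(5)) auto
    also have "\<dots> = 6000 / d / (1 + norm (j - z) / d) ^ 6 * norm v" by simp
    finally show "norm (u j z / (\<Sum>i\<in>I. u i z) * (\<Sum>i\<in>I. u i z / (\<Sum>i\<in>I. u i z) * (L j v - L i v)))
       \<le> 6000 / d / (1 + norm (j - z) / d) ^ 6 * norm v" .
  qed
qed

lemma frechet_derivative_Re_Im:
  fixes f :: "complex \<Rightarrow> 'b::real_normed_vector"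
  assumes "f differentiable (at z)"
  shows "frechet_derivative f (at z) v =
    Re v *\<^sub>R frechet_derivative f (at z) 1 + Im v *\<^sub>R frechet_derivative f (at z) \<i>"
proof -
  have "v = Re v *\<^sub>R 1 + Im v *\<^sub>R \<i>" by (simp add: complex_eq_iff)
  then have "frechet_derivative f (at z) v = frechet_derivative f (at z) (Re v *\<^sub>R 1 + Im v *\<^sub>R \<i>)" by simp
  then show ?thesis
    using linear_frechet_derivative[OF assms] by (simp only: linear_add linear_scale)
qed

text \<open>One modulus serves both inequalities: the first comes from the derivatives in the
  directions 1 and \<i>, with \<open>e / 2\<close> for each, the second from the mean value
  inequality for \<open>f\<close> minus its linear part at \<open>w\<close> along a segment.\<close>

lemma C1_Taylor_modulus:
  fixes f :: "complex \<Rightarrow> complex"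
  assumes "compact S" "convex S" "open U" "S \<subseteq> U" "0 < e"
    and diff: "\<And>z. z \<in> U \<Longrightarrow> f differentiable (at z)"
    and cont: "\<And>v. continuous_on U (\<lambda>z. frechet_derivative f (at z) v)"
  obtains K where "0 \<le> K"
    "\<And>z w v. z \<in> S \<Longrightarrow> w \<in> S \<Longrightarrow>
       norm (frechet_derivative f (at z) v - frechet_derivative f (at w) v) \<le> (e + K * norm (z - w)) * norm v"
    "\<And>z w. z \<in> S \<Longrightarrow> w \<in> S \<Longrightarrow>
       norm (f z - f w - frechet_derivative f (at w) (z - w)) \<le> (e + K * norm (z - w)) * norm (z - w)"
proof -
  let ?D = "\<lambda>z. frechet_derivative f (at z)"
  have lin: "linear (?D z)" if "z \<in> S" for z
    using linear_frechet_derivative diff that assms(4) by blast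
  have D: "(f has_derivative ?D z) (at z)" if "z \<in> S" for z
    using frechet_derivative_works diff that assms(4) by blast
  have cS: "continuous_on S (\<lambda>z. ?D z v)" for v by (rule continuous_on_subset[OF cont assms(4)])
  have e2: "0 < e / 2" using assms(5) by simp
  obtain K1 where K1: "0 \<le> K1" "\<And>x y. x \<in> S \<Longrightarrow> y \<in> S \<Longrightarrow> norm (?D x 1 - ?D y 1) \<le> e / 2 + K1 * dist x y"
    by (rule uniformly_continuous_modulus[OF assms(1) cS[of 1] e2]) auto
  obtain K2 where K2: "0 \<le> K2" "\<And>x y. x \<in> S \<Longrightarrow> y \<in> S \<Longrightarrow> norm (?D x \<i> - ?D y \<i>) \<le> e / 2 + K2 * dist x y"
    by (rule uniformly_continuous_modulus[OF assms(1) cS[of \<i>] e2]) auto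
  define K where "K = K1 + K2"
  have split: "?D z v = Re v *\<^sub>R ?D z 1 + Im v *\<^sub>R ?D z \<i>" if "z \<in> S" for z v
    using that assms(4) by (intro frechet_derivative_Re_Im diff) auto
  have mod: "norm (?D z v - ?D w v) \<le> (e + K * norm (z - w)) * norm v" if "z \<in> S" "w \<in> S" for z w v
  proof -
    have "?D z v - ?D w v = Re v *\<^sub>R (?D z 1 - ?D w 1) + Im v *\<^sub>R (?D z \<i> - ?D w \<i>)"
      unfolding split[OF that(1), of v] split[OF that(2), of v] by (simp add: algebra_simps)
    also have "norm \<dots> \<le> \<bar>Re v\<bar> * norm (?D z 1 - ?D w 1) + \<bar>Im v\<bar> * norm (?D z \<i> - ?D w \<i>)"
      by (rule norm_triangle_le) simp
    also have "\<dots> \<le> norm v * (e / 2 + K1 * norm (z - w)) + norm v * (e / 2 + K2 * norm (z - w))"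
      using K1(2)[OF that] K2(2)[OF that] abs_Re_le_cmod[of v] abs_Im_le_cmod[of v]
      by (intro add_mono mult_mono) (auto simp: dist_norm)
    also have "\<dots> = (e + K * norm (z - w)) * norm v" by (simp add: K_def algebra_simps)
    finally show ?thesis .
  qed
  have "norm (f z - f w - ?D w (z - w)) \<le> (e + K * norm (z - w)) * norm (z - w)" if zw: "z \<in> S" "w \<in> S" for z w
  proof -
    have seg: "closed_segment w z \<subseteq> S" using closed_segment_subset[OF zw(2,1) assms(2)] .
    have "norm ((f z - ?D w z) - (f w - ?D w w)) \<le> (e + K * norm (z - w)) * norm (z - w)"
    proof (rule differentiable_bound[where S = "closed_segment w z" and f' = "\<lambda>x v. ?D x v - ?D w v"])
      fix x assume x: "x \<in> closed_segment w z"
      then have xS: "x \<in> S" using seg by auto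
      have "(?D w has_derivative ?D w) (at x)"
        by (rule bounded_linear_imp_has_derivative[OF has_derivative_bounded_linear[OF D[OF zw(2)]]])
      then show "((\<lambda>x. f x - ?D w x) has_derivative (\<lambda>v. ?D x v - ?D w v)) (at x within closed_segment w z)"
        by (intro has_derivative_at_withinI[OF has_derivative_diff[OF D[OF xS]]])
      have "norm (x - w) \<le> norm (z - w)" using segment_bound[OF x] by (simp add: norm_minus_commute)
      then have "(e + K * norm (x - w)) * norm v \<le> (e + K * norm (z - w)) * norm v" for v :: complex
        using K1(1) K2(1) by (intro mult_right_mono add_left_mono mult_left_mono) (auto simp: K_def)
      then show "onorm (\<lambda>v. ?D x v - ?D w v) \<le> e + K * norm (z - w)"
        using mod[OF xS zw(2)] by (intro onorm_le) (meson order_trans)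
    qed auto
    moreover have "f z - f w - ?D w (z - w) = (f z - ?D w z) - (f w - ?D w w)"
      unfolding linear_diff[OF lin[OF zw(2)]] by simp
    ultimately show ?thesis by (simp only:)
  qed
  note taylor = this
  have "0 \<le> K" using K1(1) K2(1) by (simp add: K_def)
  then show thesis using mod taylor by (rule that)
qed

text \<open>A weighted mean of the first-order Taylor polynomials at the points of a
  \<open>d\<close>-net. The derivatives of the weights are of size \<open>1 / d\<close>, while a
  Taylor polynomial errs by the distance times the modulus of the derivative; the extra factor of
  distance cancels \<open>1 / d\<close>, at the price of one power of decay.\<close>

lemma C1_approximation_disc:
  fixes f :: "complex \<Rightarrow> complex"
  assumes "r < 1" "0 < \<epsilon>"
    and diff: "\<And>z. z \<in> ball 0 1 \<Longrightarrow> f differentiable (at z)"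
    and cont: "\<And>v. continuous_on (ball 0 1) (\<lambda>z. frechet_derivative f (at z) v)"
  obtains P where "smooth_on UNIV P"
    "\<And>z. norm z \<le> r \<Longrightarrow> norm (P z - f z) \<le> \<epsilon>"
    "\<And>z v. norm z \<le> r \<Longrightarrow> norm (frechet_derivative P (at z) v - frechet_derivative f (at z) v) \<le> \<epsilon> * norm v"
proof -
  let ?D = "\<lambda>z. frechet_derivative f (at z)"
  \<comment> \<open>3584000 = 7000 * 2 * 256: the constants 6000 and 1000 of the weights,
    \<open>e + K * d \<le> 2 * e\<close>, and the sum over the net.\<close>
  define e where "e = \<epsilon> / 3584000"
  have e: "0 < e" using assms(2) by (simp add: e_def)
  have sub: "cball 0 r \<subseteq> ball (0::complex) 1" using assms(1) by auto
  obtain K where K: "0 \<le> K"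
    "\<And>z w v. z \<in> cball 0 r \<Longrightarrow> w \<in> cball 0 r \<Longrightarrow> norm (?D z v - ?D w v) \<le> (e + K * norm (z - w)) * norm v"
    "\<And>z w. z \<in> cball 0 r \<Longrightarrow> w \<in> cball 0 r \<Longrightarrow>
       norm (f z - f w - ?D w (z - w)) \<le> (e + K * norm (z - w)) * norm (z - w)"
    by (rule C1_Taylor_modulus[OF compact_cball convex_cball open_ball sub e diff cont]) auto
  \<comment> \<open>The bound 1 disposes of a spare factor \<open>d\<close> in the error of the
    values; the other one gives \<open>K * d \<le> e\<close>.\<close>
  define d where "d = min 1 (e / (K + 1))"
  have d: "0 < d" "d \<le> 1" using e K(1) by (auto simp: d_def)
  have "K * d \<le> (K + 1) * (e / (K + 1))" using K(1) d(1) e by (intro mult_mono) (auto simp: d_def)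
  then have Kd: "e + K * d \<le> 2 * e" using K(1) by simp
  obtain I :: "complex set" where I: "finite I" "I \<subseteq> cball 0 r" "\<And>a. a \<in> cball 0 r \<Longrightarrow> \<exists>i\<in>I. norm (i - a) \<le> 2 * d"
    "\<And>a. (\<Sum>i\<in>I. 1 / (1 + norm (i - a) / d) ^ 4) \<le> 256"
    by (rule grid_net[OF bounded_cball[of 0 r] d(1)]) auto
  define u where "u = (\<lambda>k x. inverse ((of_real (d\<^sup>2) + (x - k) * cnj (x - k)) ^ 3))"
  define \<psi> where "\<psi> = (\<lambda>j x. u j x / (\<Sum>i\<in>I. u i x))"
  define T where "T = (\<lambda>k x. f k + ?D k (x - k))"
  define P where "P = (\<lambda>x. \<Sum>k\<in>I. \<psi> k x * T k x)"
  have nz: "(\<Sum>i\<in>I. u i x) \<noteq> 0" if "j \<in> I" for j x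
    using net_weights(1)[OF I(1) d(1) that, of j j] that d by (simp add: u_def)
  have bl: "bounded_linear (?D k)" if "k \<in> I" for k
    using that I(2) sub diff frechet_derivative_works has_derivative_bounded_linear by blast
  have smooth: "smooth_on UNIV P"
  proof -
    have lin: "smooth_on UNIV (\<lambda>x. x - k)" "smooth_on UNIV (\<lambda>x. cnj (x - k))" for k
    proof -
      show "smooth_on UNIV (\<lambda>x. x - k)"
        by (intro smooth_on_diff smooth_on_linear smooth_on_const bounded_linear_ident) auto
      then show "smooth_on UNIV (\<lambda>x. cnj (x - k))"
        by (intro smooth_on_linear_comp[OF bounded_linear_cnj]) auto
    qed
    have "of_real (d\<^sup>2) + (x - k) * cnj (x - k) \<noteq> 0" for x k :: complex
    proof -
      have "of_real (d\<^sup>2) + (x - k) * cnj (x - k) = complex_of_real (d\<^sup>2 + (norm (x - k))\<^sup>2)"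
        by (simp only: of_real_add complex_norm_square)
      moreover have "d\<^sup>2 + (norm (x - k))\<^sup>2 \<noteq> 0" using d(1) by (simp add: add_pos_nonneg less_imp_neq[symmetric])
      ultimately show ?thesis by (simp only: of_real_eq_0_iff) simp
    qed
    then have su: "smooth_on UNIV (u k)" for k
      unfolding u_def
      by (intro smooth_on_inverse smooth_on_power smooth_on_add smooth_on_mult smooth_on_const lin) auto
    have "smooth_on UNIV (\<psi> k)" if "k \<in> I" for k
      unfolding \<psi>_def divide_inverse using nz[OF that]
      by (intro smooth_on_mult smooth_on_inverse smooth_on_sum su) auto
    moreover have "smooth_on UNIV (T k)" if "k \<in> I" for k
      unfolding T_def
      by (rule smooth_on_add[OF open_UNIV smooth_on_const[OF open_UNIV] smooth_on_linear_comp[OF bl[OF that] open_UNIV lin(1)]])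
    ultimately show ?thesis unfolding P_def by (intro smooth_on_sum smooth_on_mult) auto
  qed
  have main: "norm (P z - f z) \<le> \<epsilon> \<and>
     norm (frechet_derivative P (at z) v - ?D z v) \<le> \<epsilon> * norm v" if z: "norm z \<le> r" for z v
  proof -
    have zb: "z \<in> cball 0 r" using z by simp
    obtain l where l: "l \<in> I" "norm (l - z) \<le> 2 * d" using I(3)[OF zb] by auto
    note w = net_weights[OF I(1) d(1) l]
    define y where "y = (\<lambda>j. norm (j - z) / d)"
    have y: "0 \<le> y j" for j using d(1) by (simp add: y_def)
    have "\<forall>j\<in>I. \<exists>D. (\<psi> j has_derivative D) (at z) \<and> (\<forall>v. norm (D v) \<le> 6000 / d / (1 + y j) ^ 6 * norm v)"
    proof
      fix j assume "j \<in> I"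
      from w(3)[OF this] show "\<exists>D. (\<psi> j has_derivative D) (at z) \<and> (\<forall>v. norm (D v) \<le> 6000 / d / (1 + y j) ^ 6 * norm v)"
        unfolding \<psi>_def y_def u_def .
    qed
    from bchoice[OF this] obtain D\<psi> where D\<psi>: "\<And>j. j \<in> I \<Longrightarrow> (\<psi> j has_derivative D\<psi> j) (at z)"
      "\<And>j v. j \<in> I \<Longrightarrow> norm (D\<psi> j v) \<le> 6000 / d / (1 + y j) ^ 6 * norm v"
      by auto
    define A where "A = (\<lambda>j. 1000 / (1 + y j) ^ 6)"
    define A' where "A' = (\<lambda>j. 6000 / d / (1 + y j) ^ 6)"
    define Y where "Y = (\<lambda>j. e + K * norm (j - z))"
    define X where "X = (\<lambda>j. Y j * norm (j - z))"
    have Y: "0 \<le> Y j" for j using e K(1) by (simp add: Y_def)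
    have dP: "(T j has_derivative ?D j) (at z)" if "j \<in> I" for j
    proof -
      have "((\<lambda>x. x - j) has_derivative (\<lambda>v. v)) (at z)" by (auto intro!: derivative_eq_intros)
      from has_derivative_add[OF has_derivative_const bounded_linear.has_derivative[OF bl[OF that] this]]
      show ?thesis unfolding T_def by simp
    qed
    have df: "(f has_derivative ?D z) (at z)"
      using zb sub diff frechet_derivative_works by blast
    have X: "norm (T j z - f z) \<le> X j" if "j \<in> I" for j
    proof -
      have "norm (T j z - f z) = norm (f z - f j - ?D j (z - j))"
        by (simp add: T_def norm_minus_commute diff_diff_eq)
      then show ?thesis using K(3)[OF zb, of j] that I(2) by (auto simp: X_def Y_def norm_minus_commute)
    qed
    have Y': "norm (?D j v - ?D z v) \<le> Y j * norm v" if "j \<in> I" for j v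
      using K(2)[of j z v] zb that I(2) by (auto simp: Y_def)
    have one: "(\<Sum>i\<in>I. \<psi> i x) = 1" for x
      using nz[OF l(1), of x] by (simp add: \<psi>_def flip: sum_divide_distrib)
    have A: "norm (\<psi> j z) \<le> A j" if "j \<in> I" for j
      using w(2)[OF that] unfolding A_def \<psi>_def y_def u_def .
    have B: "norm (D\<psi> j v) \<le> A' j * norm v" if "j \<in> I" for j v
      using D\<psi>(2)[OF that] by (simp add: A'_def)
    have err: "1 / (1 + y j) ^ 5 * Y j \<le> 2 * e * (1 / (1 + y j) ^ 4)" for j
    proof -
      have "1 / (1 + y j) ^ 5 * Y j \<le> (e + K * d) * (1 / (1 + y j) ^ 4)"
        unfolding y_def Y_def using e K(1) d(1) by (intro weighted_error_bound) auto
      also have "\<dots> \<le> 2 * e * (1 / (1 + y j) ^ 4)" using Kd y[of j] by (intro mult_right_mono) auto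
      finally show ?thesis .
    qed
    have p5: "1 / (1 + y j) ^ 6 * y j \<le> 1 / (1 + y j) ^ 5" for j
    proof -
      have "1 / (1 + y j) ^ 6 * y j \<le> 1 / (1 + y j) ^ 6 * (1 + y j)" using y[of j] by (intro mult_left_mono) auto
      also have "\<dots> = 1 / (1 + y j) ^ 5" using y[of j] by (simp add: divide_simps power_numeral_reduce)
      finally show ?thesis .
    qed
    have p6: "1 / (1 + y j) ^ 6 \<le> 1 / (1 + y j) ^ 5" for j
      using y[of j] by (intro divide_left_mono power_increasing) auto
    have nd: "norm (j - z) = d * y j" for j using d(1) by (simp add: y_def)
    have AX: "A j * X j \<le> 1000 * (2 * e * (1 / (1 + y j) ^ 4))" for j
    proof -
      have "A j * X j = 1000 * d * ((1 / (1 + y j) ^ 6 * y j) * Y j)"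
        by (simp add: A_def X_def nd)
      also have "\<dots> \<le> 1000 * 1 * (1 / (1 + y j) ^ 5 * Y j)"
        using d y[of j] Y[of j] by (intro mult_mono p5) auto
      finally show ?thesis using err[of j] by linarith
    qed
    have A'X: "A' j * X j + A j * Y j \<le> 7000 * (2 * e * (1 / (1 + y j) ^ 4))" for j
    proof -
      have "A' j * X j = 6000 * ((1 / (1 + y j) ^ 6 * y j) * Y j)"
        using d(1) by (simp add: A'_def X_def nd)
      also have "\<dots> \<le> 6000 * (1 / (1 + y j) ^ 5 * Y j)"
        using Y[of j] by (intro mult_left_mono mult_right_mono p5) auto
      finally have 1: "A' j * X j \<le> 6000 * (1 / (1 + y j) ^ 5 * Y j)" .
      have "A j * Y j = 1000 * (1 / (1 + y j) ^ 6 * Y j)" by (simp add: A_def)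
      also have "\<dots> \<le> 1000 * (1 / (1 + y j) ^ 5 * Y j)"
        using Y[of j] by (intro mult_left_mono mult_right_mono p6) auto
      finally show ?thesis using 1 err[of j] by linarith
    qed
    have tot: "(\<Sum>j\<in>I. c * (2 * e * (1 / (1 + y j) ^ 4))) \<le> \<epsilon>" if "0 \<le> c" "c \<le> 7000" for c
    proof -
      have "(\<Sum>j\<in>I. c * (2 * e * (1 / (1 + y j) ^ 4))) = c * (2 * e) * (\<Sum>j\<in>I. 1 / (1 + y j) ^ 4)"
        by (simp add: sum_distrib_left mult.assoc)
      also have "\<dots> \<le> 7000 * (2 * e) * 256"
        using I(4)[of z] e that y by (intro mult_mono sum_nonneg) (auto simp: y_def)
      finally show ?thesis by (simp add: e_def)
    qed
    note wm = weighted_mean_C1_bound[where P = T and \<psi> = \<psi> and X = X and Y = Y and DP = ?D and A = A and A' = A', OF I(1) open_UNIV UNIV_I one D\<psi>(1) dP df A B X Y', folded P_def]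
    have "norm (P z - f z) \<le> (\<Sum>i\<in>I. A i * X i)" using wm(1) by (simp add: P_def)
    also have "\<dots> \<le> \<epsilon>" using order_trans[OF sum_mono[of I, OF AX] tot[of 1000]] by simp
    finally have 1: "norm (P z - f z) \<le> \<epsilon>" .
    have "(\<Sum>i\<in>I. A' i * X i + A i * Y i) \<le> \<epsilon>" using order_trans[OF sum_mono[of I, OF A'X] tot[of 7000]] by simp
    then have "(\<Sum>i\<in>I. A' i * X i + A i * Y i) * norm v \<le> \<epsilon> * norm v" by (intro mult_right_mono) auto
    then show ?thesis using 1 wm(2)[where v = v] by simp
  qed
  show thesis using that[OF smooth] main by blast
qed

section \<open>Transversal regularity of laminations\<close>

lemma graph_lamination_facts:
  assumes "graph_lamination \<tau> \<phi>"
  shows "compact \<tau>"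
    and "a \<in> \<tau> \<Longrightarrow> \<phi> a holomorphic_on ball 0 1"
    and "a \<in> \<tau> \<Longrightarrow> \<phi> a 0 = a"
    and "a \<in> \<tau> \<Longrightarrow> z \<in> ball 0 1 \<Longrightarrow> norm (\<phi> a z) < 1"
    and "a \<in> \<tau> \<Longrightarrow> b \<in> \<tau> \<Longrightarrow> a \<noteq> b \<Longrightarrow> z \<in> ball 0 1 \<Longrightarrow> \<phi> a z \<noteq> \<phi> b z"
proof -
  show "compact \<tau>"
    using assms bounded_subset[OF bounded_ball, of \<tau> 0 1] by (simp add: graph_lamination_def compact_eq_bounded_closed)
  show "a \<in> \<tau> \<Longrightarrow> \<phi> a holomorphic_on ball 0 1" "a \<in> \<tau> \<Longrightarrow> \<phi> a 0 = a"
    using assms by (auto simp: graph_lamination_def)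
  show "a \<in> \<tau> \<Longrightarrow> z \<in> ball 0 1 \<Longrightarrow> norm (\<phi> a z) < 1"
    using assms unfolding graph_lamination_def by fastforce
  assume ab: "a \<in> \<tau>" "b \<in> \<tau>" "a \<noteq> b" and z: "z \<in> ball 0 1"
  show "\<phi> a z \<noteq> \<phi> b z"
  proof
    assume "\<phi> a z = \<phi> b z"
    then have "(z, \<phi> a z) \<in> leaf \<phi> a \<inter> leaf \<phi> b" using z by (auto simp: leaf_def)
    then show False using assms ab unfolding graph_lamination_def disjoint_family_on_def by blast
  qed
qed

text \<open>The function \<open>3 / (\<phi> a - \<phi> b)\<close> omits 0 and 1, and bounding its
  value at 0 by its value at \<open>z\<close> bounds the difference at \<open>z\<close> in terms of
  that at 0. So the holonomy is Hoelder continuous with exponent \<open>1 / M\<close>, uniformly on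
  \<open>cball 0 r\<close>.\<close>

lemma lamination_Hoelder:
  assumes "graph_lamination \<tau> \<phi>" "r < 1"
  obtains C :: real and M :: nat where "0 \<le> C" "1 \<le> M"
    "\<And>a b z. a \<in> \<tau> \<Longrightarrow> b \<in> \<tau> \<Longrightarrow> norm z \<le> r \<Longrightarrow> norm (\<phi> a z - \<phi> b z) ^ M \<le> C * norm (a - b)"
proof -
  note lam = graph_lamination_facts[OF assms(1)]
  obtain C :: real and M :: nat where CM: "1 \<le> C" "1 \<le> M"
    "\<And>f z w. f holomorphic_on ball 0 1 \<Longrightarrow> (\<And>z. z \<in> ball 0 1 \<Longrightarrow> f z \<noteq> 0 \<and> f z \<noteq> 1) \<Longrightarrow>
       norm z \<le> r \<Longrightarrow> norm w \<le> r \<Longrightarrow> norm (f z) \<le> C * max 1 (norm (f w)) ^ M"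
    by (rule Schottky_Harnack[OF assms(2)]) auto
  show thesis
  proof (rule that[of "C * 3 ^ M" M])
    fix a b z :: complex
    assume ab: "a \<in> \<tau>" "b \<in> \<tau>" and z: "norm z \<le> r"
    show "norm (\<phi> a z - \<phi> b z) ^ M \<le> C * 3 ^ M * norm (a - b)"
    proof (cases "a = b")
      case True
      then show ?thesis using CM(2) by (simp add: power_0_left)
    next
      case False
      \<comment> \<open>The leaves stay in the unit disc, so 3 exceeds the difference and
        \<open>R\<close> has modulus above 1; this also removes the maximum with 1 from the
        bound.\<close>
      define R where "R = (\<lambda>x. 3 / (\<phi> a x - \<phi> b x))"
      have nz: "\<phi> a x - \<phi> b x \<noteq> 0" if "x \<in> ball 0 1" for x
        using lam(5)[OF ab False that] by simp
      have big: "1 < norm (R x)" if "x \<in> ball 0 1" for x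
      proof -
        have "norm (\<phi> a x - \<phi> b x) < 3"
          using norm_triangle_ineq4[of "\<phi> a x" "\<phi> b x"] lam(4)[OF ab(1) that] lam(4)[OF ab(2) that] by linarith
        then show ?thesis using nz[OF that] by (simp add: R_def norm_divide)
      qed
      have zb: "z \<in> ball 0 1" using z assms(2) by simp
      have "norm (R 0) \<le> C * max 1 (norm (R z)) ^ M"
      proof (rule CM(3)[where f = R])
        show "R holomorphic_on ball 0 1"
          unfolding R_def using lam(2) ab nz by (intro holomorphic_intros) auto
        show "R x \<noteq> 0 \<and> R x \<noteq> 1" if "x \<in> ball 0 1" for x
          using big[OF that] by auto
      qed (use z order_trans[OF norm_ge_zero z] in auto)
      also have "max 1 (norm (R z)) = 3 / norm (\<phi> a z - \<phi> b z)"
        using big[OF zb] by (simp add: R_def norm_divide)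
      finally have "3 / norm (a - b) \<le> C * (3 ^ M / norm (\<phi> a z - \<phi> b z) ^ M)"
        using lam(3) ab by (simp add: R_def norm_divide power_divide)
      then have "3 * norm (\<phi> a z - \<phi> b z) ^ M \<le> C * 3 ^ M * norm (a - b)"
        using nz[OF zb] False by (simp add: field_simps)
      moreover have "0 \<le> norm (\<phi> a z - \<phi> b z) ^ M" by simp
      ultimately show ?thesis by linarith
    qed
  qed (use CM in auto)
qed

text \<open>Transversally by the Hoelder bound, which is uniform in \<open>z\<close>; along the
  single leaf through the limit point by holomorphy.\<close>

lemma lamination_continuous:
  assumes "graph_lamination \<tau> \<phi>" "r < 1"
  shows "continuous_on (cball 0 r \<times> \<tau>) (\<lambda>x. \<phi> (snd x) (fst x))"
  unfolding continuous_on_def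
proof
  note lam = graph_lamination_facts[OF assms(1)]
  obtain C :: real and M :: nat where CM: "0 \<le> C" "1 \<le> M"
    "\<And>a b z. a \<in> \<tau> \<Longrightarrow> b \<in> \<tau> \<Longrightarrow> norm z \<le> r \<Longrightarrow> norm (\<phi> a z - \<phi> b z) ^ M \<le> C * norm (a - b)"
    by (rule lamination_Hoelder[OF assms]) auto
  fix p :: "complex \<times> complex" assume p: "p \<in> cball 0 r \<times> \<tau>"
  let ?F = "at p within cball 0 r \<times> \<tau>"
  have b: "snd p \<in> \<tau>" and w: "fst p \<in> ball 0 1" using p assms(2) by auto
  have "((\<lambda>x. norm (\<phi> (snd x) (fst x) - \<phi> (snd p) (fst x)) ^ M) \<longlongrightarrow> 0) ?F"
  proof (rule tendsto_sandwich[OF _ _ tendsto_const])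
    show "\<forall>\<^sub>F x in ?F. norm (\<phi> (snd x) (fst x) - \<phi> (snd p) (fst x)) ^ M \<le> C * norm (snd x - snd p)"
      unfolding eventually_at_filter using CM(3) b by (intro always_eventually) auto
    have "((\<lambda>x. C * norm (snd x - snd p)) \<longlongrightarrow> C * norm (snd p - snd p)) ?F" by (intro tendsto_intros)
    then show "((\<lambda>x. C * norm (snd x - snd p)) \<longlongrightarrow> 0) ?F" by simp
  qed simp
  then have "((\<lambda>x. \<phi> (snd x) (fst x) - \<phi> (snd p) (fst x)) \<longlongrightarrow> 0) ?F"
    using CM(2) by (simp add: power_tendsto_0_iff tendsto_norm_zero_iff)
  moreover have "((\<lambda>x. \<phi> (snd p) (fst x)) \<longlongrightarrow> \<phi> (snd p) (fst p)) ?F"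
  proof (rule isCont_tendsto_compose[where g = "\<phi> (snd p)"])
    show "isCont (\<phi> (snd p)) (fst p)"
      using holomorphic_on_imp_continuous_on[OF lam(2)[OF b]] w by (simp add: continuous_on_eq_continuous_at)
  qed (intro tendsto_intros)
  ultimately have "((\<lambda>x. (\<phi> (snd x) (fst x) - \<phi> (snd p) (fst x)) + \<phi> (snd p) (fst x)) \<longlongrightarrow> 0 + \<phi> (snd p) (fst p)) ?F"
    by (rule tendsto_add)
  then show "((\<lambda>x. \<phi> (snd x) (fst x)) \<longlongrightarrow> \<phi> (snd p) (fst p)) ?F" by simp
qed

text \<open>The continuous parametrisation by \<open>(z, \<alpha>)\<close> pulls \<open>h\<close>
  back to the compact set \<open>cball 0 r \<times> \<tau>\<close>, so the distance of two leaves
  can be measured over 0, by \<open>norm (a - b)\<close>.\<close>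

lemma lamination_transversal_modulus:
  fixes h :: "complex \<times> complex \<Rightarrow> 'b::real_normed_vector"
  assumes "graph_lamination \<tau> \<phi>" "r < 1" "continuous_on (\<Union>\<alpha>\<in>\<tau>. leaf \<phi> \<alpha>) h" "0 < e"
  obtains K where "0 \<le> K"
    "\<And>a b z. a \<in> \<tau> \<Longrightarrow> b \<in> \<tau> \<Longrightarrow> norm z \<le> r \<Longrightarrow> norm (h (z, \<phi> a z) - h (z, \<phi> b z)) \<le> e + K * norm (a - b)"
proof -
  have "continuous_on (cball 0 r \<times> \<tau>) (\<lambda>x. h (fst x, \<phi> (snd x) (fst x)))"
  proof (rule continuous_on_compose2[OF assms(3)])
    show "continuous_on (cball 0 r \<times> \<tau>) (\<lambda>x. (fst x, \<phi> (snd x) (fst x)))"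
      by (intro continuous_intros lamination_continuous assms)
    show "(\<lambda>x. (fst x, \<phi> (snd x) (fst x))) ` (cball 0 r \<times> \<tau>) \<subseteq> (\<Union>\<alpha>\<in>\<tau>. leaf \<phi> \<alpha>)"
      using assms(2) by (auto simp: leaf_def)
  qed
  moreover have "compact (cball (0::complex) r \<times> \<tau>)"
    using graph_lamination_facts(1)[OF assms(1)] by (intro compact_Times compact_cball)
  ultimately obtain K where K: "0 \<le> K" "\<And>x y. x \<in> cball 0 r \<times> \<tau> \<Longrightarrow> y \<in> cball 0 r \<times> \<tau> \<Longrightarrow>
      norm (h (fst x, \<phi> (snd x) (fst x)) - h (fst y, \<phi> (snd y) (fst y))) \<le> e + K * dist x y"
    using uniformly_continuous_modulus[OF _ _ assms(4)] by (metis (no_types, lifting))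
  show thesis
  proof (rule that[OF K(1)])
    fix a b z :: complex assume "a \<in> \<tau>" "b \<in> \<tau>" "norm z \<le> r"
    then show "norm (h (z, \<phi> a z) - h (z, \<phi> b z)) \<le> e + K * norm (a - b)"
      using K(2)[of "(z, a)" "(z, b)"] by (simp add: dist_Pair_Pair dist_norm)
  qed
qed

text \<open>For three distinct leaves the ratio \<open>(\<phi> i - \<phi> a) / (\<phi> l - \<phi> a)\<close> omits 0 and 1, because the leaves are
  disjoint. So the polynomial Schottky bounds compare relative distances of leaves at different
  points of the disc.\<close>

lemma lamination_ratio:
  assumes "graph_lamination \<tau> \<phi>" "r < 1"
  obtains C :: real and M :: nat where "1 \<le> C" "1 \<le> M"
    "\<And>a i l z. a \<in> \<tau> \<Longrightarrow> i \<in> \<tau> \<Longrightarrow> l \<in> \<tau> \<Longrightarrow> a \<noteq> i \<Longrightarrow> a \<noteq> l \<Longrightarrow> i \<noteq> l \<Longrightarrow> norm z \<le> r \<Longrightarrow>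
       norm (i - a) / norm (l - a) \<le> C * max 1 (norm (\<phi> i z - \<phi> a z) / norm (\<phi> l z - \<phi> a z)) ^ M"
    "\<And>a i l z. a \<in> \<tau> \<Longrightarrow> i \<in> \<tau> \<Longrightarrow> l \<in> \<tau> \<Longrightarrow> a \<noteq> i \<Longrightarrow> a \<noteq> l \<Longrightarrow> i \<noteq> l \<Longrightarrow> norm z \<le> r \<Longrightarrow>
       norm ((deriv (\<phi> i) z - deriv (\<phi> a) z) / (\<phi> i z - \<phi> a z) - (deriv (\<phi> l) z - deriv (\<phi> a) z) / (\<phi> l z - \<phi> a z))
       \<le> C * max 1 (norm (\<phi> i z - \<phi> a z) / norm (\<phi> l z - \<phi> a z)) ^ M
           * (norm (\<phi> l z - \<phi> a z) / norm (\<phi> i z - \<phi> a z))"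
proof -
  note lam = graph_lamination_facts[OF assms(1)]
  obtain C1 :: real and M1 :: nat where CM1: "1 \<le> C1" "1 \<le> M1"
    "\<And>f z w. f holomorphic_on ball 0 1 \<Longrightarrow> (\<And>z. z \<in> ball 0 1 \<Longrightarrow> f z \<noteq> 0 \<and> f z \<noteq> 1) \<Longrightarrow>
       norm z \<le> r \<Longrightarrow> norm w \<le> r \<Longrightarrow> norm (f z) \<le> C1 * max 1 (norm (f w)) ^ M1"
    by (rule Schottky_Harnack[OF assms(2)]) auto
  obtain C2 :: real and M2 :: nat where CM2: "1 \<le> C2" "1 \<le> M2"
    "\<And>f z. f holomorphic_on ball 0 1 \<Longrightarrow> (\<And>z. z \<in> ball 0 1 \<Longrightarrow> f z \<noteq> 0 \<and> f z \<noteq> 1) \<Longrightarrow>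
       norm z \<le> r \<Longrightarrow> norm (deriv f z) \<le> C2 * max 1 (norm (f z)) ^ M2"
    by (rule Schottky_deriv[OF assms(2)]) auto
  define C where "C = max C1 C2"
  define M where "M = max M1 M2"
  have mono: "c * max 1 x ^ n \<le> C * max 1 x ^ M" if "c = C1 \<and> n = M1 \<or> c = C2 \<and> n = M2" for c x n
    using that CM1(1) CM2(1) by (intro mult_mono power_increasing) (auto simp: C_def M_def)
  show thesis
  proof (rule that[of C M])
    fix a i l z :: complex
    assume t: "a \<in> \<tau>" "i \<in> \<tau>" "l \<in> \<tau>" "a \<noteq> i" "a \<noteq> l" "i \<noteq> l" and z: "norm z \<le> r"
    define R where "R = (\<lambda>x. (\<phi> i x - \<phi> a x) / (\<phi> l x - \<phi> a x))"
    have zb: "z \<in> ball 0 1" using z assms(2) by simp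
    have nz: "\<phi> i x - \<phi> a x \<noteq> 0" "\<phi> l x - \<phi> a x \<noteq> 0" if "x \<in> ball 0 1" for x
      using lam(5)[OF t(1,2,4) that] lam(5)[OF t(1,3,5) that] by auto
    have hol: "R holomorphic_on ball 0 1"
      unfolding R_def using lam(2) t nz by (intro holomorphic_intros) auto
    have omit: "R x \<noteq> 0 \<and> R x \<noteq> 1" if "x \<in> ball 0 1" for x
      using nz[OF that] lam(5)[OF t(2,3,6) that] by (auto simp: R_def)
    have nR: "norm (R x) = norm (\<phi> i x - \<phi> a x) / norm (\<phi> l x - \<phi> a x)" for x
      by (simp add: R_def norm_divide)
    \<comment> \<open>A leaf is indexed by its point over 0, hence
      \<open>R 0 = (i - a) / (l - a)\<close>.\<close>
    have "norm (R 0) \<le> C1 * max 1 (norm (R z)) ^ M1"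
      using CM1(3)[OF hol omit] z order_trans[OF norm_ge_zero z] by simp
    also have "\<dots> \<le> C * max 1 (norm (R z)) ^ M" by (rule mono) simp
    finally show "norm (i - a) / norm (l - a) \<le> C * max 1 (norm (\<phi> i z - \<phi> a z) / norm (\<phi> l z - \<phi> a z)) ^ M"
      unfolding nR using lam(3) t by simp
    have dR: "(R has_field_derivative
       ((deriv (\<phi> i) z - deriv (\<phi> a) z) * (\<phi> l z - \<phi> a z) - (\<phi> i z - \<phi> a z) * (deriv (\<phi> l) z - deriv (\<phi> a) z))
         / ((\<phi> l z - \<phi> a z) * (\<phi> l z - \<phi> a z))) (at z)"
      unfolding R_def using lam(2) t zb nz[OF zb]
      by (intro DERIV_divide DERIV_diff holomorphic_derivI[of _ "ball 0 1"]) auto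
    have "(deriv (\<phi> i) z - deriv (\<phi> a) z) / (\<phi> i z - \<phi> a z) - (deriv (\<phi> l) z - deriv (\<phi> a) z) / (\<phi> l z - \<phi> a z)
       = deriv R z / R z"
    proof -
      have "p / x - q / y = ((p * y - x * q) / (y * y)) / (x / y)" if "x \<noteq> 0" "y \<noteq> 0" for p q x y :: complex
        using that by (simp add: divide_simps)
      from this[OF nz[OF zb]] show ?thesis unfolding DERIV_imp_deriv[OF dR] by (simp only: R_def)
    qed
    then have "norm ((deriv (\<phi> i) z - deriv (\<phi> a) z) / (\<phi> i z - \<phi> a z) - (deriv (\<phi> l) z - deriv (\<phi> a) z) / (\<phi> l z - \<phi> a z))
       = norm (deriv R z) * (1 / norm (R z))" by (simp add: norm_divide)
    also have "\<dots> \<le> C * max 1 (norm (R z)) ^ M * (1 / norm (R z))"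
      by (intro mult_right_mono order_trans[OF CM2(3)[OF hol omit z] mono]) auto
    finally show "norm ((deriv (\<phi> i) z - deriv (\<phi> a) z) / (\<phi> i z - \<phi> a z) - (deriv (\<phi> l) z - deriv (\<phi> a) z) / (\<phi> l z - \<phi> a z))
       \<le> C * max 1 (norm (\<phi> i z - \<phi> a z) / norm (\<phi> l z - \<phi> a z)) ^ M
           * (norm (\<phi> l z - \<phi> a z) / norm (\<phi> i z - \<phi> a z))"
      unfolding nR by simp
  qed (use CM1 CM2 in \<open>auto simp: C_def M_def\<close>)
qed

section \<open>Weights along the leaves\<close>

text \<open>Relates two measures of distance: \<open>s\<close> is relative to the nearest leaf of
  the net over \<open>z\<close>, and \<open>y\<close> is in units of \<open>d\<close> over 0. The
  constant 3 arises as 1 + 2 from the two summands of \<open>1 + y\<close>.\<close>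

lemma leaf_weight_domination:
  fixes C s y :: real
  assumes "1 \<le> C" "1 \<le> s" "0 \<le> y" "y \<le> C * s ^ M * 2"
  shows "(1 / s) ^ M \<le> 3 * C / (1 + y)"
proof -
  have sM: "1 \<le> s ^ M" using assms(2) by (rule one_le_power)
  have "1 \<le> C * s ^ M" using mult_mono[OF assms(1) sM] assms(1) by simp
  then have "1 + y \<le> 3 * C * s ^ M" using assms(4) by linarith
  then have "(1 + y) / s ^ M \<le> 3 * C" using sM by (simp add: divide_le_eq)
  then show ?thesis using assms(3) by (simp add: field_simps power_divide)
qed

text \<open>The constants precede \<open>d\<close> and \<open>I\<close>, which is the uniformity
  that the approximation needs. The weights live in the fibre over \<open>z\<close>, the net in the
  fibre over 0, and the leaf nearest to that of \<open>a\<close> may differ between the two; the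
  polynomial bounds mediate. The leaves of the net are excluded for \<open>a\<close> because the
  inverse powers are singular there.\<close>

lemma leaf_weights:
  assumes "graph_lamination \<tau> \<phi>" "r < 1"
  obtains B :: real and m :: nat where "0 < B" "0 < m"
    "\<And>d I a l j z. 0 < d \<Longrightarrow> finite I \<Longrightarrow> I \<subseteq> \<tau> \<Longrightarrow> a \<in> \<tau> - I \<Longrightarrow> l \<in> I \<Longrightarrow> norm (l - a) \<le> 2 * d \<Longrightarrow>
       (\<Sum>i\<in>I. 1 / (1 + norm (i - a) / d) ^ 4) \<le> 256 \<Longrightarrow> j \<in> I \<Longrightarrow> norm z \<le> r \<Longrightarrow>
       norm (inverse (((\<phi> j z - \<phi> a z) * cnj (\<phi> j z - \<phi> a z)) ^ m)
          / (\<Sum>i\<in>I. inverse (((\<phi> i z - \<phi> a z) * cnj (\<phi> i z - \<phi> a z)) ^ m)))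
         \<le> B / (1 + norm (j - a) / d) ^ 5 \<and>
       (\<exists>D. ((\<lambda>x. inverse (((\<phi> j x - \<phi> a x) * cnj (\<phi> j x - \<phi> a x)) ^ m)
          / (\<Sum>i\<in>I. inverse (((\<phi> i x - \<phi> a x) * cnj (\<phi> i x - \<phi> a x)) ^ m))) has_derivative D) (at z) \<and>
         (\<forall>v. norm (D v) \<le> B / (1 + norm (j - a) / d) ^ 5 * norm v))"
proof -
  note lam = graph_lamination_facts[OF assms(1)]
  obtain C :: real and M :: nat where CM: "1 \<le> C" "1 \<le> M"
    and ratio: "\<And>a i l z. a \<in> \<tau> \<Longrightarrow> i \<in> \<tau> \<Longrightarrow> l \<in> \<tau> \<Longrightarrow> a \<noteq> i \<Longrightarrow> a \<noteq> l \<Longrightarrow> i \<noteq> l \<Longrightarrow> norm z \<le> r \<Longrightarrow>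
       norm (i - a) / norm (l - a) \<le> C * max 1 (norm (\<phi> i z - \<phi> a z) / norm (\<phi> l z - \<phi> a z)) ^ M"
    and logd: "\<And>a i l z. a \<in> \<tau> \<Longrightarrow> i \<in> \<tau> \<Longrightarrow> l \<in> \<tau> \<Longrightarrow> a \<noteq> i \<Longrightarrow> a \<noteq> l \<Longrightarrow> i \<noteq> l \<Longrightarrow> norm z \<le> r \<Longrightarrow>
       norm ((deriv (\<phi> i) z - deriv (\<phi> a) z) / (\<phi> i z - \<phi> a z) - (deriv (\<phi> l) z - deriv (\<phi> a) z) / (\<phi> l z - \<phi> a z))
       \<le> C * max 1 (norm (\<phi> i z - \<phi> a z) / norm (\<phi> l z - \<phi> a z)) ^ M
           * (norm (\<phi> l z - \<phi> a z) / norm (\<phi> i z - \<phi> a z))"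
    by (rule lamination_ratio[OF assms]) auto
  \<comment> \<open>A weight is then the power \<open>6 * M\<close> of an inverse distance, so after
    normalisation it is at most \<open>t i ^ 6\<close>, with \<open>t i\<close> the
    \<open>M\<close>-th power of the relative proximity. One of the six powers pays for the
    logarithmic derivative.\<close>
  define m where "m = 3 * M"
  define B1 where "B1 = (3 * C) ^ 5"
  \<comment> \<open>512 = 2 * 256, from the two conjugate terms in the derivative of a squared
    modulus and from the sum over the net; \<open>B1\<close> enters once for the summed index and
    once for \<open>j\<close>.\<close>
  define B where "B = B1 + 512 * real m * C * B1 * B1"
  have B1: "1 \<le> B1" unfolding B1_def using CM(1) by (intro one_le_power) simp
  have B: "B1 \<le> B" "512 * real m * C * B1 * B1 \<le> B" using B1 CM(1) by (auto simp: B_def)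
  show thesis
  proof (rule that[of B m])
    show "0 < B" using B(1) B1 by linarith
    show "0 < m" using CM(2) by (simp add: m_def)
  next
    fix d :: real and I and a l j z :: complex
    assume d: "0 < d" and I: "finite I" "I \<subseteq> \<tau>" and a: "a \<in> \<tau> - I" and l: "l \<in> I" "norm (l - a) \<le> 2 * d"
      and net: "(\<Sum>i\<in>I. 1 / (1 + norm (i - a) / d) ^ 4) \<le> 256" and j: "j \<in> I" and z: "norm z \<le> r"
    have zb: "z \<in> ball 0 1" using z assms(2) by simp
    have at: "a \<in> \<tau>" "i \<in> \<tau>" "a \<noteq> i" if "i \<in> I" for i using a that I(2) by auto
    define g where "g = (\<lambda>i x. \<phi> i x - \<phi> a x)"
    define u where "u = (\<lambda>i x. inverse ((g i x * cnj (g i x)) ^ m))"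
    define x where "x = (\<lambda>i. norm (g i z))"
    have x: "0 < x i" if "i \<in> I" for i
      using lam(5)[OF at(1)[OF that] at(2)[OF that] at(3)[OF that] zb] by (simp add: x_def g_def)
    have gz: "g i z \<noteq> 0" if "i \<in> I" for i using x[OF that] by (simp add: x_def)
    \<comment> \<open>The nearest leaf of the net over \<open>z\<close>, the reference for all
      distances in this fibre.\<close>
    obtain k where k: "k \<in> I" "\<And>i. i \<in> I \<Longrightarrow> x k \<le> x i"
      using arg_min_if_finite(1)[OF I(1), of x] arg_min_least[OF I(1), of _ x] l(1) by (metis empty_iff)
    define s where "s = (\<lambda>i. x i / x k)"
    have s: "1 \<le> s i" if "i \<in> I" for i using k(2)[OF that] x[OF k(1)] by (simp add: s_def)
    define t where "t = (\<lambda>i. (1 / s i) ^ M)"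
    define y where "y = (\<lambda>i. norm (i - a) / d)"
    have y: "0 \<le> y i" for i using d by (simp add: y_def)
    have t: "0 < t i" "t i \<le> 1" if "i \<in> I" for i
      using s[OF that] by (auto simp: t_def power_le_one)
    have ty: "t i \<le> 3 * C / (1 + y i)" if i: "i \<in> I" for i
      unfolding t_def
    proof (rule leaf_weight_domination[OF CM(1) s[OF i] y])
      \<comment> \<open>As \<open>x k \<le> x l\<close>, passing from \<open>l\<close> to
        \<open>k\<close> only enlarges the ratio. For \<open>i = l\<close> the ratio is the constant
        1, a value that the Schottky bounds exclude, so this case is direct.\<close>
      have "norm (i - a) \<le> C * s i ^ M * (2 * d)"
      proof (cases "i = l")
        case True
        have "1 \<le> C * s i ^ M" using mult_mono[OF CM(1) one_le_power[OF s[OF i]]] CM(1) by simp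
        then have "1 * (2 * d) \<le> C * s i ^ M * (2 * d)" using d by (intro mult_right_mono) auto
        then show ?thesis using True l(2) by simp
      next
        case False
        have "norm (i - a) / norm (l - a) \<le> C * max 1 (x i / x l) ^ M"
          using ratio[OF at(1,2)[OF i] at(2)[OF l(1)] at(3)[OF i] at(3)[OF l(1)] False z] by (simp add: x_def g_def)
        also have "max 1 (x i / x l) \<le> s i"
          using s[OF i] k(2)[OF l(1)] x[OF k(1)] x[OF i] by (auto simp: s_def intro!: divide_left_mono)
        then have "C * max 1 (x i / x l) ^ M \<le> C * s i ^ M"
          using CM(1) by (intro mult_left_mono power_mono) auto
        finally have "norm (i - a) / norm (l - a) \<le> C * s i ^ M" .
        then have "norm (i - a) \<le> C * s i ^ M * norm (l - a)"
          using at(3)[OF l(1)] by (simp add: divide_le_eq)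
        also have "\<dots> \<le> C * s i ^ M * (2 * d)"
          using l(2) CM(1) s[OF i] by (intro mult_left_mono) auto
        finally show ?thesis .
      qed
      then show "y i \<le> C * s i ^ M * 2" using d by (simp add: y_def divide_le_eq mult_ac)
    qed
    have t5: "t i ^ 5 \<le> B1 / (1 + y i) ^ 5" if "i \<in> I" for i
      using power_mono[OF ty[OF that], of 5] t(1)[OF that] by (simp add: B1_def power_divide)
    have ux: "u i z = of_real (1 / x i ^ (2 * m))" for i
    proof -
      have "g i z * cnj (g i z) = of_real ((x i)\<^sup>2)" by (simp only: x_def complex_norm_square)
      then show ?thesis by (simp add: u_def divide_inverse flip: power_mult)
    qed
    have S: "(\<Sum>i\<in>I. u i z) \<noteq> 0"
      unfolding ux by (rule norm_weight_le(2)[OF I(1) _ l(1) l(1)]) (use x in simp)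
    have w: "norm (u i z / (\<Sum>i\<in>I. u i z)) \<le> t i ^ 6" if "i \<in> I" for i
    proof -
      have "norm (u i z / (\<Sum>i\<in>I. u i z)) \<le> (1 / x i ^ (2 * m)) / (1 / x k ^ (2 * m))"
        unfolding ux by (rule norm_weight_le(1)[OF I(1) _ k(1) that]) (use x in simp)
      also have "\<dots> = t i ^ 6"
        by (simp add: t_def s_def m_def power_divide mult.commute flip: power_mult)
      finally show ?thesis .
    qed
    define q where "q = (\<lambda>i. (deriv (\<phi> i) z - deriv (\<phi> a) z) / (\<phi> i z - \<phi> a z))"
    \<comment> \<open>From \<open>x k \<le> x i\<close> follows
      \<open>x i' / x i \<le> s i'\<close>, so each of the two leaves costs one factor
      \<open>1 / t\<close>.\<close>
    have qq: "norm (q i - q i') \<le> C / (t i * t i')" if i: "i \<in> I" "i' \<in> I" for i i'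
    proof (cases "i = i'")
      case True
      then show ?thesis using t i CM(1) by simp
    next
      case False
      have "norm (q i - q i') \<le> C * max 1 (x i / x i') ^ M * (x i' / x i)"
        using logd[OF at(1,2)[OF i(1)] at(2)[OF i(2)] at(3)[OF i(1)] at(3)[OF i(2)] False z]
        by (simp add: x_def g_def q_def)
      also have "\<dots> \<le> C * s i ^ M * s i' ^ M"
      proof (intro mult_mono power_mono)
        show "max 1 (x i / x i') \<le> s i"
          using s[OF i(1)] k(2)[OF i(2)] x[OF k(1)] x[OF i(1)] by (auto simp: s_def intro!: divide_left_mono)
        have "x i' / x i \<le> s i'"
          using k(2)[OF i(1)] x[OF k(1)] x[OF i(2)] by (auto simp: s_def intro!: divide_left_mono)
        also have "\<dots> \<le> s i' ^ M" using s[OF i(2)] CM(2) by (intro self_le_power) auto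
        finally show "x i' / x i \<le> s i' ^ M" .
      qed (use CM(1) x i s[OF i(1)] in \<open>auto intro!: divide_nonneg_nonneg less_imp_le\<close>)
      also have "\<dots> = C / (t i * t i')" by (simp add: t_def power_divide)
      finally show ?thesis .
    qed
    \<comment> \<open>The logarithmic derivative of the power \<open>-2m\<close> of
      \<open>norm (g i)\<close>: minus \<open>2m\<close> times the real part of
      \<open>q i * v\<close>.\<close>
    define L where "L = (\<lambda>i v. - (of_nat m * (q i * v + cnj (q i * v))))"
    have D: "(u i has_derivative (\<lambda>v. u i z * L i v)) (at z)" if i: "i \<in> I" for i
    proof -
      have "(g i has_field_derivative (deriv (\<phi> i) z - deriv (\<phi> a) z)) (at z)"
        unfolding g_def using lam(2) at[OF i] zb
        by (intro DERIV_diff holomorphic_derivI[of _ "ball 0 1"]) auto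
      then have dg: "(g i has_derivative (\<lambda>v. (deriv (\<phi> i) z - deriv (\<phi> a) z) * v)) (at z)"
        by (simp add: has_field_derivative_def)
      have "((\<lambda>x. g i x * cnj (g i x)) has_derivative
        (\<lambda>v. g i z * cnj ((deriv (\<phi> i) z - deriv (\<phi> a) z) * v) + (deriv (\<phi> i) z - deriv (\<phi> a) z) * v * cnj (g i z))) (at z)"
        by (rule has_derivative_mult[OF dg bounded_linear.has_derivative[OF bounded_linear_cnj dg]])
      from has_derivative_inverse_power[OF this, of m]
      have "(u i has_derivative (\<lambda>v. u i z * (- (of_nat m *
         ((g i z * cnj ((deriv (\<phi> i) z - deriv (\<phi> a) z) * v) + (deriv (\<phi> i) z - deriv (\<phi> a) z) * v * cnj (g i z))
            / (g i z * cnj (g i z))))))) (at z)"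
        using gz[OF i] by (simp add: u_def)
      moreover have "(G * cnj (E * v) + E * v * cnj G) / (G * cnj G) = E / G * v + cnj (E / G * v)"
        if "G \<noteq> 0" for G E v :: complex
        using that by (simp add: divide_simps)
      from this[OF gz[OF i], of "deriv (\<phi> i) z - deriv (\<phi> a) z"]
      have "(g i z * cnj ((deriv (\<phi> i) z - deriv (\<phi> a) z) * v) + (deriv (\<phi> i) z - deriv (\<phi> a) z) * v * cnj (g i z))
            / (g i z * cnj (g i z)) = q i * v + cnj (q i * v)" for v
        unfolding q_def g_def .
      ultimately show ?thesis by (simp only: L_def)
    qed
    have LL: "norm (L i v - L i' v) \<le> 2 * real m * (C / (t i * t i')) * norm v" if i: "i \<in> I" "i' \<in> I" for i i' v
    proof -
      have "L i v - L i' v = of_nat m * ((q i' - q i) * v + cnj ((q i' - q i) * v))"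
        by (simp add: L_def algebra_simps)
      also have "norm \<dots> \<le> real m * (norm (q i' - q i) * norm v + norm (q i' - q i) * norm v)"
        unfolding norm_mult by (intro mult_mono norm_triangle_le) (auto simp: norm_mult simp del: complex_cnj_mult)
      also have "\<dots> = 2 * real m * norm (q i - q i') * norm v" by (simp add: norm_minus_commute)
      also have "\<dots> \<le> 2 * real m * (C / (t i * t i')) * norm v"
        by (intro mult_right_mono mult_left_mono qq i) auto
      finally show ?thesis .
    qed
    have t1: "t j ^ 6 \<le> t j ^ 5" using t[OF j] by (intro power_decreasing) auto
    have b1: "norm (u j z / (\<Sum>i\<in>I. u i z)) \<le> B / (1 + y j) ^ 5"
      using w[OF j] t1 t5[OF j] divide_right_mono[OF B(1), of "(1 + y j) ^ 5"] y[of j] by simp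
    have b2: "norm (u j z / (\<Sum>i\<in>I. u i z) * (\<Sum>i\<in>I. u i z / (\<Sum>i\<in>I. u i z) * (L j v - L i v)))
        \<le> B / (1 + y j) ^ 5 * norm v" for v
    proof -
      \<comment> \<open>Of \<open>t i ^ 6 / t i\<close> a fifth power is left, and the net bounds
        the sum of fourth powers. The factor \<open>1 / t j\<close> is paid by the outer
        weight.\<close>
      have "norm (\<Sum>i\<in>I. u i z / (\<Sum>i\<in>I. u i z) * (L j v - L i v)) \<le>
         (\<Sum>i\<in>I. (2 * real m * C * norm v * B1 / t j) * (1 / (1 + y i) ^ 4))"
      proof (rule sum_norm_le)
        fix i assume i: "i \<in> I"
        have "norm (u i z / (\<Sum>i\<in>I. u i z) * (L j v - L i v)) \<le> t i ^ 6 * (2 * real m * (C / (t j * t i)) * norm v)"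
          unfolding norm_mult[of "u i z / _"] by (intro mult_mono w LL i j) (use t[OF i] in auto)
        also have "\<dots> = 2 * real m * C * norm v / t j * t i ^ 5"
          using t[OF i] t[OF j] by (simp add: field_simps power_numeral_reduce)
        also have "\<dots> \<le> 2 * real m * C * norm v / t j * (B1 / (1 + y i) ^ 5)"
          using t[OF j] CM(1) by (intro mult_left_mono t5 i divide_nonneg_nonneg mult_nonneg_nonneg) auto
        also have "\<dots> = 2 * real m * C * norm v * B1 / t j * (1 / (1 + y i) ^ 5)" by simp
        also have "\<dots> \<le> 2 * real m * C * norm v * B1 / t j * (1 / (1 + y i) ^ 4)"
          using t[OF j] CM(1) B1 y[of i]
          by (intro mult_left_mono divide_left_mono power_increasing divide_nonneg_nonneg mult_nonneg_nonneg) auto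
        finally show "norm (u i z / (\<Sum>i\<in>I. u i z) * (L j v - L i v))
          \<le> (2 * real m * C * norm v * B1 / t j) * (1 / (1 + y i) ^ 4)" .
      qed
      also have "\<dots> = (2 * real m * C * norm v * B1 / t j) * (\<Sum>i\<in>I. 1 / (1 + y i) ^ 4)"
        by (simp only: sum_distrib_left)
      also have "\<dots> \<le> (2 * real m * C * norm v * B1 / t j) * 256"
        using t[OF j] CM(1) B1 net by (intro mult_left_mono divide_nonneg_nonneg mult_nonneg_nonneg) (auto simp: y_def)
      finally have "norm (u j z / (\<Sum>i\<in>I. u i z) * (\<Sum>i\<in>I. u i z / (\<Sum>i\<in>I. u i z) * (L j v - L i v)))
        \<le> t j ^ 6 * (2 * real m * C * norm v * B1 / t j * 256)"
        unfolding norm_mult[of "u j z / _"] using t[OF j] by (intro mult_mono w j) auto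
      also have "\<dots> = 512 * real m * C * B1 * norm v * t j ^ 5"
        using t[OF j] by (simp add: field_simps power_numeral_reduce)
      also have "\<dots> \<le> 512 * real m * C * B1 * norm v * (B1 / (1 + y j) ^ 5)"
        using CM(1) B1 by (intro mult_left_mono t5 j mult_nonneg_nonneg) auto
      also have "\<dots> = 512 * real m * C * B1 * B1 / (1 + y j) ^ 5 * norm v" by simp
      also have "\<dots> \<le> B / (1 + y j) ^ 5 * norm v"
        using y[of j] by (intro mult_right_mono divide_right_mono B) auto
      finally show ?thesis .
    qed
    have "((\<lambda>x. u j x / (\<Sum>i\<in>I. u i x)) has_derivative
      (\<lambda>v. u j z / (\<Sum>i\<in>I. u i z) * (\<Sum>i\<in>I. u i z / (\<Sum>i\<in>I. u i z) * (L j v - L i v)))) (at z)"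
      by (rule has_derivative_weight[OF D S j])
    with b1 b2 have "norm (u j z / (\<Sum>i\<in>I. u i z)) \<le> B / (1 + y j) ^ 5 \<and>
      (\<exists>D. ((\<lambda>x. u j x / (\<Sum>i\<in>I. u i x)) has_derivative D) (at z) \<and> (\<forall>v. norm (D v) \<le> B / (1 + y j) ^ 5 * norm v))"
      by blast
    then show "norm (inverse (((\<phi> j z - \<phi> a z) * cnj (\<phi> j z - \<phi> a z)) ^ m)
          / (\<Sum>i\<in>I. inverse (((\<phi> i z - \<phi> a z) * cnj (\<phi> i z - \<phi> a z)) ^ m)))
         \<le> B / (1 + norm (j - a) / d) ^ 5 \<and>
       (\<exists>D. ((\<lambda>x. inverse (((\<phi> j x - \<phi> a x) * cnj (\<phi> j x - \<phi> a x)) ^ m)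
          / (\<Sum>i\<in>I. inverse (((\<phi> i x - \<phi> a x) * cnj (\<phi> i x - \<phi> a x)) ^ m))) has_derivative D) (at z) \<and>
         (\<forall>v. norm (D v) \<le> B / (1 + norm (j - a) / d) ^ 5 * norm v))"
      unfolding u_def g_def y_def .
  qed
qed

section \<open>Approximation of leafwise differentiable functions\<close>

lemma C1_laminationD:
  assumes "graph_lamination \<tau> \<phi>" "C1_lamination \<tau> \<phi> f"
  shows "a \<in> \<tau> \<Longrightarrow> z \<in> ball 0 1 \<Longrightarrow> on_leaf \<phi> a f differentiable (at z)"
    and "a \<in> \<tau> \<Longrightarrow> continuous_on (ball 0 1) (\<lambda>z. frechet_derivative (on_leaf \<phi> a f) (at z) v)"
    and "r < 1 \<Longrightarrow> 0 < e \<Longrightarrow> \<exists>K\<ge>0. \<forall>a\<in>\<tau>. \<forall>b\<in>\<tau>. \<forall>z. norm z \<le> r \<longrightarrow>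
           norm (f (z, \<phi> a z) - f (z, \<phi> b z)) \<le> e + K * norm (a - b) \<and>
           (\<forall>v. norm (frechet_derivative (on_leaf \<phi> a f) (at z) v - frechet_derivative (on_leaf \<phi> b f) (at z) v)
             \<le> (e + K * norm (a - b)) * norm v)"
proof -
  note lam = graph_lamination_facts[OF assms(1)]
  let ?D = "\<lambda>a z. frechet_derivative (on_leaf \<phi> a f) (at z)"
  show diff: "on_leaf \<phi> a f differentiable (at z)" if "a \<in> \<tau>" "z \<in> ball 0 1" for a z
    using assms(2) that by (simp add: C1_lamination_def)
  have contf: "continuous_on (\<Union>\<alpha>\<in>\<tau>. leaf \<phi> \<alpha>) f" using assms(2) by (simp add: C1_lamination_def)
  obtain G where contG: "continuous_on (\<Union>\<alpha>\<in>\<tau>. leaf \<phi> \<alpha>) G"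
    and G: "\<And>\<alpha> z. \<alpha> \<in> \<tau> \<Longrightarrow> z \<in> ball 0 1 \<Longrightarrow> G (z, \<phi> \<alpha> z) = leaf_grad \<phi> \<alpha> f z"
    using assms(2) unfolding C1_lamination_def by blast
  have D: "?D a z v = Re v *\<^sub>R fst (G (z, \<phi> a z)) + Im v *\<^sub>R snd (G (z, \<phi> a z))"
    if "a \<in> \<tau>" "z \<in> ball 0 1" for a z v
    by (subst frechet_derivative_Re_Im[OF diff[OF that]]) (simp add: G[OF that] leaf_grad_def)
  show "continuous_on (ball 0 1) (\<lambda>z. ?D a z v)" if a: "a \<in> \<tau>" for a v
  proof -
    have "continuous_on (ball 0 1) (\<lambda>z. G (z, \<phi> a z))"
      using lam(2)[OF a] a
      by (intro continuous_on_compose2[OF contG] continuous_intros holomorphic_on_imp_continuous_on)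
        (auto simp: leaf_def)
    then have "continuous_on (ball 0 1) (\<lambda>z. Re v *\<^sub>R fst (G (z, \<phi> a z)) + Im v *\<^sub>R snd (G (z, \<phi> a z)))"
      by (intro continuous_intros)
    then show ?thesis by (rule continuous_on_eq) (simp add: D[OF a])
  qed
  assume r: "r < 1" and e: "0 < e"
  obtain K1 where K1: "0 \<le> K1"
    "\<And>a b z. a \<in> \<tau> \<Longrightarrow> b \<in> \<tau> \<Longrightarrow> norm z \<le> r \<Longrightarrow> norm (f (z, \<phi> a z) - f (z, \<phi> b z)) \<le> e + K1 * norm (a - b)"
    by (rule lamination_transversal_modulus[OF assms(1) r contf e]) auto
  have e2: "0 < e / 2" using e by simp
  obtain K2 where K2: "0 \<le> K2"
    "\<And>a b z. a \<in> \<tau> \<Longrightarrow> b \<in> \<tau> \<Longrightarrow> norm z \<le> r \<Longrightarrow> norm (G (z, \<phi> a z) - G (z, \<phi> b z)) \<le> e / 2 + K2 * norm (a - b)"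
    by (rule lamination_transversal_modulus[OF assms(1) r contG e2]) auto
  show "\<exists>K\<ge>0. \<forall>a\<in>\<tau>. \<forall>b\<in>\<tau>. \<forall>z. norm z \<le> r \<longrightarrow>
           norm (f (z, \<phi> a z) - f (z, \<phi> b z)) \<le> e + K * norm (a - b) \<and>
           (\<forall>v. norm (?D a z v - ?D b z v) \<le> (e + K * norm (a - b)) * norm v)"
  \<comment> \<open>Each of the two components of the gradient is bounded by its norm, which doubles
    the modulus \<open>e / 2 + K2 * norm (a - b)\<close> of \<open>G\<close>.\<close>
  proof (intro exI[of _ "K1 + 2 * K2"] conjI ballI allI impI)
    show "0 \<le> K1 + 2 * K2" using K1 K2 by simp
    fix a b z v :: complex assume ab: "a \<in> \<tau>" "b \<in> \<tau>" and z: "norm z \<le> r"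
    have zb: "z \<in> ball 0 1" using z r by simp
    have "K1 * norm (a - b) \<le> (K1 + 2 * K2) * norm (a - b)"
      using K2(1) by (intro mult_right_mono) auto
    then show "norm (f (z, \<phi> a z) - f (z, \<phi> b z)) \<le> e + (K1 + 2 * K2) * norm (a - b)"
      using K1(2)[OF ab z] by linarith
    let ?H = "G (z, \<phi> a z) - G (z, \<phi> b z)"
    have "?D a z v - ?D b z v = Re v *\<^sub>R fst ?H + Im v *\<^sub>R snd ?H"
      unfolding D[OF ab(1) zb] D[OF ab(2) zb] by (simp add: algebra_simps)
    also have "norm \<dots> \<le> \<bar>Re v\<bar> * norm (fst ?H) + \<bar>Im v\<bar> * norm (snd ?H)"
      by (rule norm_triangle_le) simp
    also have "\<dots> \<le> norm v * norm ?H + norm v * norm ?H"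
      by (intro add_mono mult_mono abs_Re_le_cmod abs_Im_le_cmod)
        (use norm_fst_le[of "fst ?H" "snd ?H"] norm_snd_le[of "snd ?H" "fst ?H"] in \<open>simp_all del: fst_diff snd_diff\<close>)
    also have "\<dots> \<le> norm v * (e / 2 + K2 * norm (a - b)) + norm v * (e / 2 + K2 * norm (a - b))"
      by (intro add_mono mult_left_mono K2(2) ab z) auto
    also have "\<dots> = (e + 2 * K2 * norm (a - b)) * norm v" by (simp add: algebra_simps)
    also have "\<dots> \<le> (e + (K1 + 2 * K2) * norm (a - b)) * norm v"
      using K1(1) by (intro mult_right_mono add_left_mono) auto
    finally show "norm (?D a z v - ?D b z v) \<le> (e + (K1 + 2 * K2) * norm (a - b)) * norm v" .
  qed
qed

text \<open>By disjointness at most one leaf of the net passes through \<open>(z, w)\<close>. The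
  summand that omits its factor is positive and the others are non-negative, so the weights with
  cleared denominators are smooth on the net leaves too.\<close>

lemma lamination_weight_denominator_nonzero:
  assumes "graph_lamination \<tau> \<phi>" "finite I" "I \<subseteq> \<tau>" "I \<noteq> {}" "z \<in> ball 0 1"
  shows "(\<Sum>i\<in>I. \<Prod>k\<in>I - {i}. ((\<phi> k z - w) * cnj (\<phi> k z - w)) ^ m) \<noteq> 0"
proof -
  define R where "R = (\<lambda>i. \<Prod>k\<in>I - {i}. (norm (\<phi> k z - w)) ^ (2 * m))"
  have eq: "(\<Sum>i\<in>I. \<Prod>k\<in>I - {i}. ((\<phi> k z - w) * cnj (\<phi> k z - w)) ^ m) = of_real (\<Sum>i\<in>I. R i)"
    unfolding R_def of_real_sum of_real_prod
    by (intro sum.cong prod.cong refl) (simp only: complex_norm_square[symmetric] of_real_power power_mult)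
  obtain i where i: "i \<in> I" "\<And>k. k \<in> I - {i} \<Longrightarrow> \<phi> k z \<noteq> w"
  proof (cases "\<exists>k\<in>I. \<phi> k z = w")
    case True
    then obtain i where i: "i \<in> I" "\<phi> i z = w" by blast
    then have "\<phi> k z \<noteq> w" if "k \<in> I - {i}" for k
      using graph_lamination_facts(5)[OF assms(1), of k i z] assms(3,5) that by auto
    then show ?thesis using that i by blast
  next
    case False
    then show ?thesis using that assms(4) by blast
  qed
  have "0 < R i" unfolding R_def using i(2) by (intro prod_pos) auto
  moreover have "R i \<le> (\<Sum>i\<in>I. R i)"
    using i(1) assms(2) by (intro member_le_sum) (auto simp: R_def intro: prod_nonneg)
  ultimately show ?thesis unfolding eq of_real_eq_0_iff by linarith
qed

text \<open>Off the leaves of the net, this identifies the smooth form of the weights with the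
  inverse powers that \<open>leaf_weights\<close> estimates.\<close>

lemma normalised_inverse_eq:
  fixes q :: "'i \<Rightarrow> 'b::field"
  assumes "finite I" "\<And>k. k \<in> I \<Longrightarrow> q k \<noteq> 0" "j \<in> I"
  shows "(\<Prod>k\<in>I - {j}. q k) / (\<Sum>i\<in>I. \<Prod>k\<in>I - {i}. q k) = inverse (q j) / (\<Sum>i\<in>I. inverse (q i))"
proof -
  have Q: "(\<Prod>k\<in>I. q k) \<noteq> 0" using assms by simp
  have N: "(\<Prod>k\<in>I - {i}. q k) = (\<Prod>k\<in>I. q k) * inverse (q i)" if "i \<in> I" for i
    using assms that by (simp add: prod.remove[of I i])
  have "(\<Sum>i\<in>I. \<Prod>k\<in>I - {i}. q k) = (\<Prod>k\<in>I. q k) * (\<Sum>i\<in>I. inverse (q i))"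
    unfolding sum_distrib_left by (intro sum.cong refl N)
  then show ?thesis using N[OF assms(3)] Q by simp
qed

lemma lamination_C1_approximation:
  assumes lam0: "graph_lamination \<tau> \<phi>" and f: "C1_lamination \<tau> \<phi> f" and r: "r < 1" and \<epsilon>: "0 < \<epsilon>"
  obtains F where "smooth_on (ball 0 1 \<times> UNIV) F"
    "\<And>a z. a \<in> \<tau> \<Longrightarrow> norm z \<le> r \<Longrightarrow> norm (F (z, \<phi> a z) - f (z, \<phi> a z)) \<le> \<epsilon>"
    "\<And>a z v. a \<in> \<tau> \<Longrightarrow> norm z \<le> r \<Longrightarrow>
       norm (frechet_derivative (on_leaf \<phi> a F) (at z) v - frechet_derivative (on_leaf \<phi> a f) (at z) v) \<le> \<epsilon> * norm v"
proof -
  note lam = graph_lamination_facts[OF lam0]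
  note C1 = C1_laminationD[OF lam0 f]
  let ?D = "\<lambda>a z. frechet_derivative (on_leaf \<phi> a f) (at z)"
  obtain B :: real and m :: nat where B: "0 < B" and m: "0 < m" and weights:
    "\<And>d I a l j z. 0 < d \<Longrightarrow> finite I \<Longrightarrow> I \<subseteq> \<tau> \<Longrightarrow> a \<in> \<tau> - I \<Longrightarrow> l \<in> I \<Longrightarrow> norm (l - a) \<le> 2 * d \<Longrightarrow>
       (\<Sum>i\<in>I. 1 / (1 + norm (i - a) / d) ^ 4) \<le> 256 \<Longrightarrow> j \<in> I \<Longrightarrow> norm z \<le> r \<Longrightarrow>
       norm (inverse (((\<phi> j z - \<phi> a z) * cnj (\<phi> j z - \<phi> a z)) ^ m)
          / (\<Sum>i\<in>I. inverse (((\<phi> i z - \<phi> a z) * cnj (\<phi> i z - \<phi> a z)) ^ m)))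
         \<le> B / (1 + norm (j - a) / d) ^ 5 \<and>
       (\<exists>D. ((\<lambda>x. inverse (((\<phi> j x - \<phi> a x) * cnj (\<phi> j x - \<phi> a x)) ^ m)
          / (\<Sum>i\<in>I. inverse (((\<phi> i x - \<phi> a x) * cnj (\<phi> i x - \<phi> a x)) ^ m))) has_derivative D) (at z) \<and>
         (\<forall>v. norm (D v) \<le> B / (1 + norm (j - a) / d) ^ 5 * norm v))"
    by (rule leaf_weights[OF lam0 r]) blast
  \<comment> \<open>1536 = 2 * 3 * 256: two equal sums in the derivative estimate,
    \<open>2 * e + K * d \<le> 3 * e\<close>, and the sum over the net. The bound by
    \<open>\<epsilon>\<close> itself serves the leaves of the net.\<close>
  define e where "e = min \<epsilon> (\<epsilon> / (1536 * B))"
  have e: "0 < e" "e \<le> \<epsilon>" "1536 * B * e \<le> \<epsilon>"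
  proof -
    show "0 < e" "e \<le> \<epsilon>" using \<epsilon> B by (auto simp: e_def)
    have "1536 * B * e \<le> 1536 * B * (\<epsilon> / (1536 * B))" using B by (intro mult_left_mono) (auto simp: e_def)
    then show "1536 * B * e \<le> \<epsilon>" using B by simp
  qed
  obtain K where K: "0 \<le> K"
    and Kf: "\<And>a b z. a \<in> \<tau> \<Longrightarrow> b \<in> \<tau> \<Longrightarrow> norm z \<le> r \<Longrightarrow> norm (f (z, \<phi> a z) - f (z, \<phi> b z)) \<le> e + K * norm (a - b)"
    and KD: "\<And>a b z v. a \<in> \<tau> \<Longrightarrow> b \<in> \<tau> \<Longrightarrow> norm z \<le> r \<Longrightarrow> norm (?D a z v - ?D b z v) \<le> (e + K * norm (a - b)) * norm v"
    using C1(3)[OF r e(1)] by auto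
  \<comment> \<open>\<open>K\<close> depends on \<open>e\<close>, and \<open>e\<close> on
    \<open>B\<close>; there is no circle because \<open>B\<close> is valid for every
    \<open>d\<close>.\<close>
  define d where "d = e / (K + 1)"
  have d: "0 < d" using e K by (simp add: d_def)
  have Kd: "K * d \<le> e"
  proof -
    have "K * d \<le> (K + 1) * d" using d by (intro mult_right_mono) auto
    also have "\<dots> = e" using K by (simp add: d_def)
    finally show ?thesis .
  qed
  obtain I :: "complex set" where I: "finite I" "I \<subseteq> \<tau>" "\<And>a. a \<in> \<tau> \<Longrightarrow> \<exists>i\<in>I. norm (i - a) \<le> 2 * d"
    "\<And>a. (\<Sum>i\<in>I. 1 / (1 + norm (i - a) / d) ^ 4) \<le> 256"
    by (rule grid_net[OF compact_imp_bounded[OF lam(1)] d]) auto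
  have "\<exists>P. smooth_on UNIV P \<and> (\<forall>z. norm z \<le> r \<longrightarrow> norm (P z - on_leaf \<phi> j f z) \<le> e) \<and>
      (\<forall>z v. norm z \<le> r \<longrightarrow> norm (frechet_derivative P (at z) v - ?D j z v) \<le> e * norm v)" if "j \<in> \<tau>" for j
    by (rule C1_approximation_disc[OF r e(1) C1(1)[OF that] C1(2)[OF that]]) auto
  then have "\<forall>j\<in>\<tau>. \<exists>P. smooth_on UNIV P \<and> (\<forall>z. norm z \<le> r \<longrightarrow> norm (P z - on_leaf \<phi> j f z) \<le> e) \<and>
      (\<forall>z v. norm z \<le> r \<longrightarrow> norm (frechet_derivative P (at z) v - ?D j z v) \<le> e * norm v)" by blast
  from bchoice[OF this] obtain P where P0: "\<forall>j\<in>\<tau>. smooth_on UNIV (P j) \<and>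
      (\<forall>z. norm z \<le> r \<longrightarrow> norm (P j z - on_leaf \<phi> j f z) \<le> e) \<and>
      (\<forall>z v. norm z \<le> r \<longrightarrow> norm (frechet_derivative (P j) (at z) v - ?D j z v) \<le> e * norm v)" ..
  then have P: "\<And>j. j \<in> \<tau> \<Longrightarrow> smooth_on UNIV (P j)"
    and Pf: "\<And>j z. j \<in> \<tau> \<Longrightarrow> norm z \<le> r \<Longrightarrow> norm (P j z - f (z, \<phi> j z)) \<le> e"
    and PD: "\<And>j z v. j \<in> \<tau> \<Longrightarrow> norm z \<le> r \<Longrightarrow> norm (frechet_derivative (P j) (at z) v - ?D j z v) \<le> e * norm v"
    by (simp_all add: on_leaf_def)
  have dP: "(P j has_derivative frechet_derivative (P j) (at z)) (at z)" if "j \<in> \<tau>" for j z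
    using smooth_on_imp_differentiable[OF P[OF that] UNIV_I] frechet_derivative_works by blast
  define q where "q = (\<lambda>k x. ((\<phi> k (fst x) - snd x) * cnj (\<phi> k (fst x) - snd x)) ^ m)"
  define \<psi> where "\<psi> = (\<lambda>j x. (\<Prod>k\<in>I - {j}. q k x) / (\<Sum>i\<in>I. \<Prod>k\<in>I - {i}. q k x))"
  define F where "F = (\<lambda>x. \<Sum>j\<in>I. \<psi> j x * P j (fst x))"
  have op: "open (ball (0::complex) 1 \<times> (UNIV :: complex set))" by (simp add: open_Times)
  have nz: "(\<Sum>i\<in>I. \<Prod>k\<in>I - {i}. q k x) \<noteq> 0" if "x \<in> ball 0 1 \<times> UNIV" "I \<noteq> {}" for x
    unfolding q_def by (rule lamination_weight_denominator_nonzero[OF lam0 I(1,2) that(2)]) (use that in auto)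
  have smooth: "smooth_on (ball 0 1 \<times> UNIV) F"
  proof -
    have g: "smooth_on (ball 0 1 \<times> UNIV) (\<lambda>x. \<phi> k (fst x) - snd x)" if "k \<in> I" for k
      using that I(2) lam(2)
      by (intro smooth_on_diff[OF op] smooth_on_fst smooth_on_holomorphic smooth_on_linear[OF bounded_linear_snd op]) auto
    have sq: "smooth_on (ball 0 1 \<times> UNIV) (q k)" if "k \<in> I" for k
      unfolding q_def
      by (rule smooth_on_power[OF op smooth_on_mult[OF op g[OF that] smooth_on_linear_comp[OF bounded_linear_cnj op g[OF that]]]])
    have "smooth_on (ball 0 1 \<times> UNIV) (\<psi> j)" if "j \<in> I" for j
      unfolding \<psi>_def divide_inverse using nz that
      by (intro smooth_on_mult[OF op] smooth_on_inverse[OF op] smooth_on_sum[OF op] smooth_on_prod[OF op] sq) auto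
    moreover have "smooth_on (ball 0 1 \<times> UNIV) (\<lambda>x. P j (fst x))" if "j \<in> I" for j
    proof -
      have "smooth_on (ball 0 1) (P j)"
        using P[of j] that I(2) smooth_on_subset[of UNIV "P j" "ball 0 1"] by blast
      then show ?thesis by (rule smooth_on_fst[OF open_ball])
    qed
    ultimately show ?thesis unfolding F_def by (intro smooth_on_sum[OF op] smooth_on_mult[OF op]) auto
  qed
  have main: "norm (F (z, \<phi> a z) - f (z, \<phi> a z)) \<le> \<epsilon> \<and>
     norm (frechet_derivative (on_leaf \<phi> a F) (at z) v - ?D a z v) \<le> \<epsilon> * norm v"
    if a: "a \<in> \<tau>" and z: "norm z \<le> r" for a z v
  proof (cases "a \<in> I")
    case True
    have zb: "z \<in> ball 0 1" using z r by simp
    \<comment> \<open>On the leaf of \<open>a\<close> the factor \<open>q a\<close> vanishes, as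
      \<open>m > 0\<close>, and it occurs in every product except that of
      \<open>j = a\<close>.\<close>
    have FP: "P a x = on_leaf \<phi> a F x" if x: "x \<in> ball 0 1" for x
    proof -
      have "q a (x, \<phi> a x) = 0" using m by (simp add: q_def)
      then have z0: "(\<Prod>k\<in>I - {j}. q k (x, \<phi> a x)) = 0" if "j \<in> I" "j \<noteq> a" for j
        using that True I(1) by (intro prod_zero) auto
      have "(\<Sum>i\<in>I. \<Prod>k\<in>I - {i}. q k (x, \<phi> a x)) = (\<Prod>k\<in>I - {a}. q k (x, \<phi> a x))"
        unfolding sum.remove[OF I(1) True] using z0 by (simp add: sum.neutral del: prod_zero_iff)
      moreover have "(\<Sum>i\<in>I. \<Prod>k\<in>I - {i}. q k (x, \<phi> a x)) \<noteq> 0" using nz[of "(x, \<phi> a x)"] x True by auto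
      ultimately have "\<psi> j (x, \<phi> a x) = (if j = a then 1 else 0)" if "j \<in> I" for j
        using z0[OF that] by (simp add: \<psi>_def)
      then have "F (x, \<phi> a x) = (\<Sum>j\<in>I. if j = a then P j x else 0)"
        unfolding F_def by (intro sum.cong) auto
      then show ?thesis using True I(1) by (simp add: on_leaf_def)
    qed
    have "(on_leaf \<phi> a F has_derivative frechet_derivative (P a) (at z)) (at z)"
      by (rule has_derivative_transform_within_open[OF dP[OF a] open_ball zb FP])
    then have "frechet_derivative (on_leaf \<phi> a F) (at z) = frechet_derivative (P a) (at z)"
      by (rule frechet_derivative_at[symmetric])
    moreover have "e * norm v \<le> \<epsilon> * norm v" using e(2) by (intro mult_right_mono) auto
    ultimately show ?thesis
      using Pf[OF a z] PD[OF a z, of v] FP[OF zb] e(2) by (simp add: on_leaf_def)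
  next
    case False
    have zb: "z \<in> ball 0 1" using z r by simp
    have aI: "a \<in> \<tau> - I" using a False by simp
    obtain l where l: "l \<in> I" "norm (l - a) \<le> 2 * d" using I(3)[OF a] by auto
    define \<omega> where "\<omega> = (\<lambda>j x. inverse (((\<phi> j x - \<phi> a x) * cnj (\<phi> j x - \<phi> a x)) ^ m)
          / (\<Sum>i\<in>I. inverse (((\<phi> i x - \<phi> a x) * cnj (\<phi> i x - \<phi> a x)) ^ m)))"
    have \<psi>\<omega>: "\<psi> j (x, \<phi> a x) = \<omega> j x" if "j \<in> I" "x \<in> ball 0 1" for j x
    proof -
      have "q k (x, \<phi> a x) \<noteq> 0" if "k \<in> I" for k
        using lam(5)[OF _ a _ \<open>x \<in> ball 0 1\<close>, of k] that False I(2) by (auto simp: q_def)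
      from normalised_inverse_eq[where q = "\<lambda>k. q k (x, \<phi> a x)", OF I(1) this that(1)]
      show ?thesis unfolding \<psi>_def \<omega>_def by (simp add: q_def)
    qed
    define y where "y = (\<lambda>j. norm (j - a) / d)"
    have y: "0 \<le> y j" for j using d by (simp add: y_def)
    define A where "A = (\<lambda>j. B / (1 + y j) ^ 5)"
    \<comment> \<open>One \<open>e\<close> for replacing \<open>P j\<close> by \<open>f\<close> on
      the leaf of \<open>j\<close>, and \<open>e + K * norm (j - a)\<close> for passing to the leaf
      of \<open>a\<close>; the bound serves values and derivatives alike.\<close>
    define X where "X = (\<lambda>j. 2 * e + K * norm (j - a))"
    have W: "norm (\<omega> j z) \<le> A j \<and> (\<exists>D. (\<omega> j has_derivative D) (at z) \<and> (\<forall>v. norm (D v) \<le> A j * norm v))" if "j \<in> I" for j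
      using weights[OF d I(1,2) aI l I(4) that z] unfolding \<omega>_def A_def y_def .
    then have "\<forall>j\<in>I. \<exists>D. (\<omega> j has_derivative D) (at z) \<and> (\<forall>v. norm (D v) \<le> A j * norm v)" by blast
    from bchoice[OF this] obtain D\<omega> where D\<omega>: "\<And>j. j \<in> I \<Longrightarrow> (\<omega> j has_derivative D\<omega> j) (at z)"
      "\<And>j v. j \<in> I \<Longrightarrow> norm (D\<omega> j v) \<le> A j * norm v" by auto
    have W1: "\<And>j. j \<in> I \<Longrightarrow> norm (\<omega> j z) \<le> A j" using W by blast
    have one: "(\<Sum>j\<in>I. \<omega> j x) = 1" if "x \<in> ball 0 1" for x
    proof -
      have "(\<Sum>i\<in>I. \<Prod>k\<in>I - {i}. q k (x, \<phi> a x)) \<noteq> 0" using nz[of "(x, \<phi> a x)"] that l(1) by auto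
      then have "(\<Sum>j\<in>I. \<psi> j (x, \<phi> a x)) = 1" unfolding \<psi>_def by (simp flip: sum_divide_distrib)
      then show ?thesis using \<psi>\<omega>[OF _ that] by simp
    qed
    have X: "norm (P j z - on_leaf \<phi> a f z) \<le> X j" if "j \<in> I" for j
    proof -
      have j: "j \<in> \<tau>" using that I(2) by blast
      show ?thesis
        using norm_triangle_ineq[of "P j z - f (z, \<phi> j z)" "f (z, \<phi> j z) - f (z, \<phi> a z)"] Pf[OF j z] Kf[OF j a z]
        by (simp add: X_def on_leaf_def)
    qed
    have Y: "norm (frechet_derivative (P j) (at z) v - ?D a z v) \<le> X j * norm v" if "j \<in> I" for j v
    proof -
      have j: "j \<in> \<tau>" using that I(2) by blast
      have "norm (frechet_derivative (P j) (at z) v - ?D a z v) \<le> e * norm v + (e + K * norm (j - a)) * norm v"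
        using norm_triangle_ineq[of "frechet_derivative (P j) (at z) v - ?D j z v" "?D j z v - ?D a z v"]
          PD[OF j z, of v] KD[OF j a z, of v] by simp
      then show ?thesis by (simp add: X_def algebra_simps)
    qed
    have df: "(on_leaf \<phi> a f has_derivative ?D a z) (at z)"
      using C1(1)[OF a zb] frechet_derivative_works by blast
    have dPI: "\<And>j. j \<in> I \<Longrightarrow> (P j has_derivative frechet_derivative (P j) (at z)) (at z)" using dP I(2) by blast
    note wm = weighted_mean_C1_bound[where \<psi> = \<omega> and P = P and DP = "\<lambda>j. frechet_derivative (P j) (at z)"
        and A = A and A' = A and X = X and Y = X, OF I(1) open_ball zb one D\<omega>(1) dPI df W1 D\<omega>(2) X Y]
    have tot: "(\<Sum>j\<in>I. A j * X j) \<le> 768 * B * e"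
    proof -
      have "(\<Sum>j\<in>I. A j * X j) \<le> (\<Sum>j\<in>I. 3 * B * e * (1 / (1 + y j) ^ 4))"
      proof (rule sum_mono)
        fix j
        have "A j * X j = B * (1 / (1 + y j) ^ 5 * (2 * e + K * norm (j - a)))" by (simp add: A_def X_def)
        also have "\<dots> \<le> B * ((2 * e + K * d) * (1 / (1 + y j) ^ 4))"
          unfolding y_def using B e K d by (intro mult_left_mono weighted_error_bound) auto
        also have "\<dots> \<le> B * (3 * e * (1 / (1 + y j) ^ 4))"
          using B Kd y[of j] by (intro mult_left_mono mult_right_mono) auto
        finally show "A j * X j \<le> 3 * B * e * (1 / (1 + y j) ^ 4)" by (simp add: mult_ac)
      qed
      also have "\<dots> = 3 * B * e * (\<Sum>j\<in>I. 1 / (1 + y j) ^ 4)" by (simp only: sum_distrib_left)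
      also have "\<dots> \<le> 3 * B * e * 256" using B e I(4)[of a] by (intro mult_left_mono) (auto simp: y_def)
      finally show ?thesis by simp
    qed
    have nn: "0 \<le> B * e" using B e by simp
    have Fleaf: "on_leaf \<phi> a F x = (\<Sum>j\<in>I. \<omega> j x * P j x)" if "x \<in> ball 0 1" for x
      using \<psi>\<omega>[OF _ that] by (simp add: on_leaf_def F_def)
    have "norm (F (z, \<phi> a z) - f (z, \<phi> a z)) \<le> (\<Sum>j\<in>I. A j * X j)"
      using wm(1) Fleaf[OF zb] by (simp add: on_leaf_def)
    also have "\<dots> \<le> \<epsilon>" using tot e(3) nn by linarith
    finally have 1: "norm (F (z, \<phi> a z) - f (z, \<phi> a z)) \<le> \<epsilon>" .
    let ?W = "\<lambda>x. \<Sum>j\<in>I. \<omega> j x * P j x"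
    have "(?W has_derivative frechet_derivative ?W (at z)) (at z)"
    proof -
      have "(?W has_derivative (\<lambda>v. \<Sum>j\<in>I. \<omega> j z * frechet_derivative (P j) (at z) v + D\<omega> j v * P j z)) (at z)"
        by (intro has_derivative_sum has_derivative_mult D\<omega>(1) dPI)
      then show ?thesis using frechet_derivative_works differentiable_def by blast
    qed
    then have "(on_leaf \<phi> a F has_derivative frechet_derivative ?W (at z)) (at z)"
      by (rule has_derivative_transform_within_open[OF _ open_ball zb]) (simp add: Fleaf)
    then have "frechet_derivative (on_leaf \<phi> a F) (at z) = frechet_derivative ?W (at z)"
      by (rule frechet_derivative_at[symmetric])
    then have "norm (frechet_derivative (on_leaf \<phi> a F) (at z) v - ?D a z v) \<le> (\<Sum>j\<in>I. A j * X j + A j * X j) * norm v"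
      using wm(2)[where v = v] by simp
    also have "\<dots> \<le> \<epsilon> * norm v"
      unfolding sum.distrib using tot e(3) by (intro mult_right_mono) auto
    finally show ?thesis using 1 by simp
  qed
  show thesis using that[OF smooth] main by blast
qed

section \<open>Convergence in the leafwise Sobolev norms\<close>

text \<open>The unit ball has finite volume, so a uniform bound controls the integral norm for every
  exponent, which affects the constant only.\<close>

lemma Lp_norm_on_le:
  fixes g :: "'a::euclidean_space \<Rightarrow> 'b::real_normed_vector"
  assumes "K \<subseteq> ball 0 1" "0 \<le> c" "\<And>x. x \<in> K \<Longrightarrow> norm (g x) \<le> c" "1 \<le> p"
  shows "Lp_norm_on p K g \<le> ennreal (c * measure lborel (ball (0::'a) 1) powr (1 / p))"
proof -
  define V where "V = measure lborel (ball (0::'a) 1)"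
  have V: "0 \<le> V" "emeasure lborel (ball (0::'a) 1) = ennreal V"
    using emeasure_lborel_ball_finite[of "0::'a" 1] by (auto simp: V_def emeasure_eq_ennreal_measure)
  define I where "I = (\<integral>\<^sup>+x\<in>K. ennreal (norm (g x) powr p) \<partial>lborel)"
  have "I \<le> (\<integral>\<^sup>+x. ennreal (c powr p) * indicator (ball (0::'a) 1) x \<partial>lborel)"
    unfolding I_def
  proof (rule nn_integral_mono)
    fix x :: 'a
    show "ennreal (norm (g x) powr p) * indicator K x \<le> ennreal (c powr p) * indicator (ball 0 1) x"
    proof (cases "x \<in> K")
      case True
      then have "norm (g x) powr p \<le> c powr p" using assms by (intro powr_mono2) auto
      then show ?thesis using True assms(1) by (auto intro: ennreal_leI)
    qed simp
  qed
  also have "\<dots> = ennreal (c powr p * V)"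
    using V by (simp add: nn_integral_cmult_indicator ennreal_mult)
  finally have I: "I \<le> ennreal (c powr p * V)" .
  then have "I \<noteq> \<infinity>" by (auto simp: top_unique)
  have "enn2real I \<le> c powr p * V"
    using I V by (intro enn2real_leI) auto
  then have "enn2real I powr (1 / p) \<le> (c powr p * V) powr (1 / p)"
    using assms(4) by (intro powr_mono2) auto
  also have "\<dots> = c * V powr (1 / p)"
    using assms(2,4) V(1) by (simp add: powr_mult powr_powr)
  finally show ?thesis
    using \<open>I \<noteq> \<infinity>\<close> by (simp add: Lp_norm_on_def I_def[symmetric] V_def[symmetric] ennreal_leI)
qed

text \<open>The constant collects 1 for the values and 2 for the two partial derivatives, the latter
  times the \<open>p\<close>-th root of the area of the disc.\<close>

lemma W1p_norm_on_le:
  assumes "graph_lamination \<tau> \<phi>" "C1_lamination \<tau> \<phi> f" "smooth_on (ball 0 1 \<times> UNIV) F"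
    and "1 \<le> p" "K \<subseteq> cball 0 r" "r < 1" "0 \<le> \<epsilon>"
    and F: "\<And>a z. a \<in> \<tau> \<Longrightarrow> norm z \<le> r \<Longrightarrow> norm (F (z, \<phi> a z) - f (z, \<phi> a z)) \<le> \<epsilon>"
    and DF: "\<And>a z v. a \<in> \<tau> \<Longrightarrow> norm z \<le> r \<Longrightarrow>
       norm (frechet_derivative (on_leaf \<phi> a F) (at z) v - frechet_derivative (on_leaf \<phi> a f) (at z) v) \<le> \<epsilon> * norm v"
  shows "W1p_norm_on \<tau> \<phi> p K (\<lambda>x. f x - F x)
    \<le> ennreal ((1 + 2 * measure lborel (ball (0::complex) 1) powr (1 / p)) * \<epsilon>)"
proof -
  define V where "V = measure lborel (ball (0::complex) 1) powr (1 / p)"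
  have V: "0 \<le> V" by (simp add: V_def)
  have sup: "(SUP (\<alpha>, z)\<in>\<tau> \<times> K. ennreal (norm (f (z, \<phi> \<alpha> z) - F (z, \<phi> \<alpha> z)))) \<le> ennreal \<epsilon>"
    using F assms(5) by (intro SUP_least) (auto intro!: ennreal_leI simp: norm_minus_commute)
  have grad: "norm (leaf_grad \<phi> a (\<lambda>x. f x - F x) z) \<le> 2 * \<epsilon>" if a: "a \<in> \<tau>" and z: "z \<in> K" for a z
  proof -
    have zr: "norm z \<le> r" and zb: "z \<in> ball 0 1" using z assms(5,6) by auto
    have "(on_leaf \<phi> a f has_derivative frechet_derivative (on_leaf \<phi> a f) (at z)) (at z)"
      using C1_laminationD(1)[OF assms(1,2) a zb] frechet_derivative_works by blast
    moreover have "(on_leaf \<phi> a F has_derivative frechet_derivative (on_leaf \<phi> a F) (at z)) (at z)"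
    proof -
      have "(\<lambda>z. (z, \<phi> a z)) differentiable (at z)"
        using holomorphic_on_imp_differentiable_at[OF graph_lamination_facts(2)[OF assms(1) a] open_ball zb]
        by (intro differentiable_Pair) (auto simp: field_differentiable_imp_differentiable)
      moreover have "F differentiable (at (z, \<phi> a z))"
        using smooth_on_imp_differentiable[OF assms(3)] zb by blast
      ultimately have "on_leaf \<phi> a F differentiable (at z)"
        unfolding on_leaf_def by (rule differentiable_compose[where f = F and g = "\<lambda>z. (z, \<phi> a z)", rotated])
      then show ?thesis using frechet_derivative_works by blast
    qed
    ultimately have "(on_leaf \<phi> a (\<lambda>x. f x - F x) has_derivative
       (\<lambda>v. frechet_derivative (on_leaf \<phi> a f) (at z) v - frechet_derivative (on_leaf \<phi> a F) (at z) v)) (at z)"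
      unfolding on_leaf_def by (rule has_derivative_diff)
    then have D: "frechet_derivative (on_leaf \<phi> a (\<lambda>x. f x - F x)) (at z) =
       (\<lambda>v. frechet_derivative (on_leaf \<phi> a f) (at z) v - frechet_derivative (on_leaf \<phi> a F) (at z) v)"
      by (rule frechet_derivative_at[symmetric])
    have "norm (leaf_grad \<phi> a (\<lambda>x. f x - F x) z) \<le>
      norm (frechet_derivative (on_leaf \<phi> a (\<lambda>x. f x - F x)) (at z) 1)
        + norm (frechet_derivative (on_leaf \<phi> a (\<lambda>x. f x - F x)) (at z) \<i>)"
      unfolding leaf_grad_def by (rule norm_Pair_le)
    also have "\<dots> \<le> \<epsilon> * norm (1::complex) + \<epsilon> * norm \<i>"
      unfolding D using DF[OF a zr, of 1] DF[OF a zr, of \<i>] by (intro add_mono) (simp_all add: norm_minus_commute)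
    finally show ?thesis by simp
  qed
  have "(SUP \<alpha>\<in>\<tau>. Lp_norm_on p K (leaf_grad \<phi> \<alpha> (\<lambda>x. f x - F x))) \<le> ennreal (2 * \<epsilon> * V)"
    unfolding V_def using grad assms(4-7) by (intro SUP_least Lp_norm_on_le) auto
  then have "W1p_norm_on \<tau> \<phi> p K (\<lambda>x. f x - F x) \<le> ennreal \<epsilon> + ennreal (2 * \<epsilon> * V)"
    unfolding W1p_norm_on_def by (intro add_mono sup)
  also have "\<dots> = ennreal ((1 + 2 * V) * \<epsilon>)"
    using V assms(7) by (simp add: algebra_simps flip: ennreal_plus)
  finally show ?thesis by (simp add: V_def)
qed

lemma compact_subset_smaller_disk:
  assumes "compact (K :: complex set)" "K \<subseteq> ball 0 1"
  obtains r where "r < 1" "K \<subseteq> cball 0 r"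
proof (cases "K = {}")
  case True
  then show thesis using that[of 0] by simp
next
  case False
  obtain x where x: "x \<in> K" "\<And>y. y \<in> K \<Longrightarrow> norm y \<le> norm x"
    using continuous_attains_sup[OF assms(1) False continuous_on_norm_id] by blast
  show thesis
  proof (rule that)
    show "norm x < 1" using x(1) assms(2) by auto
    show "K \<subseteq> cball 0 (norm x)" using x(2) by auto
  qed
qed

theorem mainTheorem1:
  fixes \<tau> :: "complex set"
    and \<phi> :: "complex \<Rightarrow> complex \<Rightarrow> complex"
    and p :: real
    and f :: "complex \<times> complex \<Rightarrow> complex"
  assumes "graph_lamination \<tau> \<phi>"
    and "1 < p"
    and "C1_lamination \<tau> \<phi> f"
  shows "\<exists>F :: nat \<Rightarrow> complex \<times> complex \<Rightarrow> complex.
           (\<forall>n. smooth_on (unit_disk \<times> UNIV) (F n)) \<and>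
           (\<forall>K. compact K \<and> K \<subseteq> unit_disk \<longrightarrow>
              (\<lambda>n. W1p_norm_on \<tau> \<phi> p K (\<lambda>x. f x - F n x)) \<longlonglongrightarrow> 0)"
proof -
  \<comment> \<open>One sequence has to serve all compact sets: the \<open>n\<close>-th function is
    accurate to \<open>\<epsilon> n\<close> on the disc of radius \<open>1 - \<epsilon> n\<close>,
    which eventually contains any given compact subset of the open disc.\<close>
  define \<epsilon> where "\<epsilon> = (\<lambda>n. inverse (real (Suc n)))"
  have \<epsilon>: "0 < \<epsilon> n" for n by (simp add: \<epsilon>_def)
  have lim: "\<epsilon> \<longlonglongrightarrow> 0" unfolding \<epsilon>_def by (rule LIMSEQ_inverse_real_of_nat)
  have "\<exists>F. smooth_on (ball 0 1 \<times> UNIV) F \<and>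
    (\<forall>a\<in>\<tau>. \<forall>z. norm z \<le> 1 - \<epsilon> n \<longrightarrow> norm (F (z, \<phi> a z) - f (z, \<phi> a z)) \<le> \<epsilon> n \<and>
       (\<forall>v. norm (frechet_derivative (on_leaf \<phi> a F) (at z) v - frechet_derivative (on_leaf \<phi> a f) (at z) v) \<le> \<epsilon> n * norm v))" for n
    by (rule lamination_C1_approximation[OF assms(1,3), of "1 - \<epsilon> n" "\<epsilon> n"]) (use \<epsilon> in auto)
  from choice[OF allI[OF this]] obtain F where "\<forall>n. smooth_on (ball 0 1 \<times> UNIV) (F n) \<and>
    (\<forall>a\<in>\<tau>. \<forall>z. norm z \<le> 1 - \<epsilon> n \<longrightarrow> norm (F n (z, \<phi> a z) - f (z, \<phi> a z)) \<le> \<epsilon> n \<and>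
       (\<forall>v. norm (frechet_derivative (on_leaf \<phi> a (F n)) (at z) v - frechet_derivative (on_leaf \<phi> a f) (at z) v) \<le> \<epsilon> n * norm v))" ..
  then have F: "\<And>n. smooth_on (ball 0 1 \<times> UNIV) (F n)"
    and F': "\<And>n a z. a \<in> \<tau> \<Longrightarrow> norm z \<le> 1 - \<epsilon> n \<Longrightarrow> norm (F n (z, \<phi> a z) - f (z, \<phi> a z)) \<le> \<epsilon> n"
    and DF: "\<And>n a z v. a \<in> \<tau> \<Longrightarrow> norm z \<le> 1 - \<epsilon> n \<Longrightarrow>
       norm (frechet_derivative (on_leaf \<phi> a (F n)) (at z) v - frechet_derivative (on_leaf \<phi> a f) (at z) v) \<le> \<epsilon> n * norm v"
    by blast+
  have "(\<lambda>n. W1p_norm_on \<tau> \<phi> p K (\<lambda>x. f x - F n x)) \<longlonglongrightarrow> 0" if K: "compact K" "K \<subseteq> ball 0 1" for K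
  proof (rule tendsto_sandwich[OF _ _ tendsto_const])
    let ?c = "1 + 2 * measure lborel (ball (0::complex) 1) powr (1 / p)"
    obtain r where r: "r < 1" "K \<subseteq> cball 0 r" using compact_subset_smaller_disk[OF K] .
    have "\<forall>\<^sub>F n in sequentially. \<epsilon> n < 1 - r" using r(1) by (intro order_tendstoD(2)[OF lim]) simp
    then show "\<forall>\<^sub>F n in sequentially. W1p_norm_on \<tau> \<phi> p K (\<lambda>x. f x - F n x) \<le> ennreal (?c * \<epsilon> n)"
    proof eventually_elim
      case (elim n)
      then have "K \<subseteq> cball 0 (1 - \<epsilon> n)" using r(2) by auto
      then show ?case
        using assms(2) \<epsilon>[of n] by (intro W1p_norm_on_le[OF assms(1,3) F] F' DF) auto
    qed
    have "(\<lambda>n. ?c * \<epsilon> n) \<longlonglongrightarrow> ?c * 0" by (intro tendsto_intros lim)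
    then show "(\<lambda>n. ennreal (?c * \<epsilon> n)) \<longlonglongrightarrow> 0"
      using tendsto_ennrealI by fastforce
  qed simp
  then show ?thesis using F by blast
qed

end
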